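(* Let $\omega$ and $\sigma$ be weight functions with $\sigma(t)=o(t^2)$ as $t\to\infty$. Then the following are equivalent: (i) $\omega\vartriangleleft\sigma$, i.e. $\sigma(t)=o(\omega(t))$ as $t\to\infty$; (ii) $\mathcal{S}_{\{\omega\}}(\mathbb{R}^d)\subseteq\mathcal{S}_{(\sigma)}(\mathbb{R}^d)$ holds for all dimensions $d\in\mathbb{N}$ with continuous inclusion. More precisely, the spaces in (ii) can be defined by joint or separated growth at infinity; (i)$\Rightarrow$(ii) is valid for general weight functions $\omega$ and $\sigma$; and for (ii)$\Rightarrow$(i) only the inclusion for $d=1$ is required.
   Context: $\mathbb{N}_0=\mathbb{N}\cup\{0\}$. A weight function is a continuous increasing (i.e. nondecreasing) function $\omega:[0,+\infty)\to[0,+\infty)$ such that: $(\alpha)$ there is $L\ge 1$ with $\omega(2t)\le L(\omega(t)+1)$ for all $t\ge 0$; $(\beta)$ $\omega(t)=O(t^2)$ as $t\to+\infty$; $(\gamma)$ $\log t=o(\omega(t))$ as $t\to+\infty$; $(\delta)$ $\varphi_\omega(t):=\omega(e^t)$ is convex on $[0,+\infty)$. A general weight function satisfies all these properties except possibly $(\beta)$. The Young conjugate is $\varphi^*_\omega(s):=\sup_{t\ge 0}\{ts-\varphi_\omega(t)\}$, $s\ge 0$, and $W^{(\lambda)}_\alpha:=e^{\frac1\lambda\varphi^*_\omega(\lambda|\alpha|)}$ for $\lambda>0$, $\alpha\in\mathbb{N}_0^d$. For $f\in C^\infty(\mathbb{R}^d)$ put $\|f\|_{\infty,\mathbf{W}^{(\lambda)}}:=\sup_{\alpha,\beta\in\mathbb{N}_0^d}\|x^\alpha\partial^\beta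 f\|_\infty/W^{(\lambda)}_{\alpha+\beta}$ ($\|\cdot\|_\infty$ is the supremum norm on $\mathbb{R}^d$). $\mathcal{S}_{\{\omega\}}(\mathbb{R}^d)$ is the space of all $f\in C^\infty(\mathbb{R}^d)$ with $\|f\|_{\infty,\mathbf{W}^{(\lambda)}}<\infty$ for some $\lambda>0$ (inductive limit topology over $\lambda$); $\mathcal{S}_{(\omega)}(\mathbb{R}^d)$ is the space of all $f\in C^\infty(\mathbb{R}^d)$ with $\|f\|_{\infty,\mathbf{W}^{(\lambda)}}<\infty$ for all $\lambda>0$ (projective limit topology). These are the definitions by joint growth at infinity; in the definitions by separated growth at infinity, $W^{(\lambda)}_{\alpha+\beta}$ is replaced by $W^{(\lambda)}_\alpha W^{(\lambda)}_\beta$. *)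

theory Defs
  imports "HOL-Analysis.Analysis" "HOL-Library.Landau_Symbols"
begin

section \<open>Weight functions\<close>

text \<open>
  A function on the half-line \<open>[0, \<infinity>)\<close> is represented by a function on the reals of which only the
  values at nonnegative arguments matter.
\<close>

definition general_weight_function :: "(real \<Rightarrow> real) \<Rightarrow> bool" where
  "general_weight_function \<omega> \<longleftrightarrow>
     continuous_on {0..} \<omega> \<and> mono_on {0..} \<omega> \<and> (\<forall>t\<ge>0. 0 \<le> \<omega> t) \<and>
     (\<exists>L\<ge>1. \<forall>t\<ge>0. \<omega> (2 * t) \<le> L * (\<omega> t + 1)) \<and>
     ln \<in> o[at_top](\<omega>) \<and>
     convex_on {0..} (\<lambda>t. \<omega> (exp t))"

definition weight_function :: "(real \<Rightarrow> real) \<Rightarrow> bool" where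
  "weight_function \<omega> \<longleftrightarrow> general_weight_function \<omega> \<and> \<omega> \<in> O[at_top](\<lambda>t. t\<^sup>2)"

text \<open>
  The supremum is finite for a general weight function, because \<open>log t = o(\<omega>(t))\<close>; hence the
  conjugate is real-valued.
\<close>

definition young_conjugate :: "(real \<Rightarrow> real) \<Rightarrow> real \<Rightarrow> real" where
  "young_conjugate \<omega> s = (SUP t\<in>{0..}. t * s - \<omega> (exp t))"

section \<open>Smooth functions on d-dimensional space\<close>

text \<open>
  The dimension has to be a natural number over which one can quantify, so \<open>\<real>\<^sup>d\<close> is the library space
  \<open>Euclidean_space d\<close>, whose points are the sequences \<open>x\<close> with \<open>x i = 0\<close> for \<open>i \<ge> d\<close>. Multi-indices
  are represented in the same way. A function on \<open>\<real>\<^sup>d\<close> is represented by a function on all sequences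
  that vanishes off \<open>\<real>\<^sup>d\<close>; this makes the representative unique and is compatible with the pointwise
  vector space operations.
\<close>

type_synonym field_fun = "(nat \<Rightarrow> real) \<Rightarrow> complex"

definition multi_indices :: "nat \<Rightarrow> (nat \<Rightarrow> nat) set" where
  "multi_indices d = {\<alpha>. \<forall>i\<ge>d. \<alpha> i = 0}"

definition partial_deriv :: "nat \<Rightarrow> nat \<Rightarrow> field_fun \<Rightarrow> field_fun" where
  "partial_deriv d i f x =
     (if x \<in> topspace (Euclidean_space d)
      then vector_derivative (\<lambda>t. f (x(i := t))) (at (x i)) else 0)"

definition continuous_funs :: "nat \<Rightarrow> field_fun set" where
  "continuous_funs d = {f. continuous_map (Euclidean_space d) euclidean f \<and>
                           (\<forall>x. x \<notin> topspace (Euclidean_space d) \<longrightarrow> f x = 0)}"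

primrec Ck :: "nat \<Rightarrow> nat \<Rightarrow> field_fun set" where
  "Ck d 0 = continuous_funs d"
| "Ck d (Suc k) = {f \<in> continuous_funs d. \<forall>i<d.
     (\<forall>x\<in>topspace (Euclidean_space d). (\<lambda>t. f (x(i := t))) differentiable (at (x i))) \<and>
     partial_deriv d i f \<in> Ck d k}"

definition smooth :: "nat \<Rightarrow> field_fun set" where
  "smooth d = (\<Inter>k. Ck d k)"

definition monomial :: "nat \<Rightarrow> (nat \<Rightarrow> nat) \<Rightarrow> (nat \<Rightarrow> real) \<Rightarrow> real" where
  "monomial d \<alpha> x = (\<Prod>i<d. x i ^ \<alpha> i)"

text \<open>\<open>\<partial>\<^sup>\<beta> f = \<partial>\<^sub>0\<^bsup>\<beta> 0\<^esup> (\<partial>\<^sub>1\<^bsup>\<beta> 1\<^esup> (\<dots> f))\<close>\<close>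

definition multi_deriv :: "nat \<Rightarrow> (nat \<Rightarrow> nat) \<Rightarrow> field_fun \<Rightarrow> field_fun" where
  "multi_deriv d \<beta> f = foldr (\<lambda>i. partial_deriv d i ^^ \<beta> i) [0..<d] f"

definition sup_norm :: "nat \<Rightarrow> field_fun \<Rightarrow> ennreal" where
  "sup_norm d f = (SUP x\<in>topspace (Euclidean_space d). ennreal (norm (f x)))"

section \<open>Locally convex limits of spaces of functions\<close>

text \<open>
  The inductive limit topology is the locally convex one: \<open>U\<close> is open if each of its points \<open>f\<close>
  has a neighbourhood \<open>f + V \<subseteq> U\<close>, where \<open>V\<close> is a convex balanced set that contains \<open>0\<close> and
  meets every step in an open set of that step.
\<close>

definition convex_balanced :: "('a \<Rightarrow> complex) set \<Rightarrow> bool" where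
  "convex_balanced V \<longleftrightarrow>
     (\<lambda>x. 0) \<in> V \<and>
     (\<forall>f\<in>V. \<forall>g\<in>V. \<forall>u\<in>{0..1}. (\<lambda>x. of_real (1 - u) * f x + of_real u * g x) \<in> V) \<and>
     (\<forall>f\<in>V. \<forall>c. norm c \<le> 1 \<longrightarrow> (\<lambda>x. c * f x) \<in> V)"

definition inductive_limit ::
    "'i set \<Rightarrow> ('i \<Rightarrow> ('a \<Rightarrow> complex) topology) \<Rightarrow> ('a \<Rightarrow> complex) topology" where
  "inductive_limit I X = topology (\<lambda>U. U \<subseteq> (\<Union>i\<in>I. topspace (X i)) \<and>
     (\<forall>f\<in>U. \<exists>V. V \<subseteq> (\<Union>i\<in>I. topspace (X i)) \<and> convex_balanced V \<and>
        (\<forall>i\<in>I. openin (X i) (V \<inter> topspace (X i))) \<and>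
        (\<forall>g\<in>V. (\<lambda>x. f x + g x) \<in> U)))"

lemma convex_balanced_Int:
  "convex_balanced V \<Longrightarrow> convex_balanced W \<Longrightarrow> convex_balanced (V \<inter> W)"
  by (simp add: convex_balanced_def)

lemma openin_inductive_limit:
  "openin (inductive_limit I X) U \<longleftrightarrow> U \<subseteq> (\<Union>i\<in>I. topspace (X i)) \<and>
     (\<forall>f\<in>U. \<exists>V. V \<subseteq> (\<Union>i\<in>I. topspace (X i)) \<and> convex_balanced V \<and>
        (\<forall>i\<in>I. openin (X i) (V \<inter> topspace (X i))) \<and>
        (\<forall>g\<in>V. (\<lambda>x. f x + g x) \<in> U))" (is "_ = ?P U")
proof -
  have inter: "?P (S \<inter> T)" if S: "?P S" and T: "?P T" for S T
  proof (intro conjI ballI)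
    show "S \<inter> T \<subseteq> (\<Union>i\<in>I. topspace (X i))" using S by blast
    fix f assume f: "f \<in> S \<inter> T"
    obtain V where V: "V \<subseteq> (\<Union>i\<in>I. topspace (X i))" "convex_balanced V"
      "\<And>i. i \<in> I \<Longrightarrow> openin (X i) (V \<inter> topspace (X i))" "\<And>g. g \<in> V \<Longrightarrow> (\<lambda>x. f x + g x) \<in> S"
      using S f by (meson IntD1)
    obtain W where W: "convex_balanced W"
      "\<And>i. i \<in> I \<Longrightarrow> openin (X i) (W \<inter> topspace (X i))" "\<And>g. g \<in> W \<Longrightarrow> (\<lambda>x. f x + g x) \<in> T"
      using T f by (meson IntD2)
    have "openin (X i) (V \<inter> W \<inter> topspace (X i))" if "i \<in> I" for i
    proof -
      have "V \<inter> W \<inter> topspace (X i) = (V \<inter> topspace (X i)) \<inter> (W \<inter> topspace (X i))" by blast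
      then show ?thesis using V(3) W(2) that by (simp add: openin_Int)
    qed
    then show "\<exists>V. V \<subseteq> (\<Union>i\<in>I. topspace (X i)) \<and> convex_balanced V \<and>
        (\<forall>i\<in>I. openin (X i) (V \<inter> topspace (X i))) \<and>
        (\<forall>g\<in>V. (\<lambda>x. f x + g x) \<in> S \<inter> T)"
      using V W convex_balanced_Int by (intro exI[of _ "V \<inter> W"]) blast
  qed
  have union: "?P (\<Union>K)" if K: "\<And>S. S \<in> K \<Longrightarrow> ?P S" for K
  proof (intro conjI ballI)
    show "\<Union>K \<subseteq> (\<Union>i\<in>I. topspace (X i))" using K by blast
    fix f assume "f \<in> \<Union>K"
    then obtain S where S: "S \<in> K" "f \<in> S" by blast
    then obtain V where "V \<subseteq> (\<Union>i\<in>I. topspace (X i))" "convex_balanced V"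
      "\<forall>i\<in>I. openin (X i) (V \<inter> topspace (X i))" "\<forall>g\<in>V. (\<lambda>x. f x + g x) \<in> S"
      using K[OF S(1)] by meson
    then show "\<exists>V. V \<subseteq> (\<Union>i\<in>I. topspace (X i)) \<and> convex_balanced V \<and>
        (\<forall>i\<in>I. openin (X i) (V \<inter> topspace (X i))) \<and> (\<forall>g\<in>V. (\<lambda>x. f x + g x) \<in> \<Union>K)"
      using S(1) by (intro exI[of _ V]) blast
  qed
  have "istopology ?P"
    unfolding istopology_def
    apply (rule conjI)
     apply (intro allI impI)
     apply (rule inter; assumption)
    apply (intro allI impI)
    apply (rule union)
    apply (erule bspec, assumption)
    done
  then show ?thesis
    unfolding inductive_limit_def by (simp add: topology_inverse')
qed

text \<open>The initial topology with respect to the inclusions of the intersection into the steps.\<close>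

definition projective_limit ::
    "'i set \<Rightarrow> ('i \<Rightarrow> 'b topology) \<Rightarrow> 'b topology" where
  "projective_limit I X = topology_generated_by
     {U \<inter> (\<Inter>j\<in>I. topspace (X j)) | i U. i \<in> I \<and> openin (X i) U}"

section \<open>The spaces of rapidly decreasing ultradifferentiable functions\<close>

datatype growth = Joint | Separated

definition weight_matrix :: "(real \<Rightarrow> real) \<Rightarrow> nat \<Rightarrow> real \<Rightarrow> (nat \<Rightarrow> nat) \<Rightarrow> real" where
  "weight_matrix \<omega> d \<kappa> \<alpha> = exp (1 / \<kappa> * young_conjugate \<omega> (\<kappa> * real (\<Sum>i<d. \<alpha> i)))"

fun growth_weight ::
    "growth \<Rightarrow> (real \<Rightarrow> real) \<Rightarrow> nat \<Rightarrow> real \<Rightarrow> (nat \<Rightarrow> nat) \<Rightarrow> (nat \<Rightarrow> nat) \<Rightarrow> real" where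
  "growth_weight Joint \<omega> d \<kappa> \<alpha> \<beta> = weight_matrix \<omega> d \<kappa> (\<lambda>i. \<alpha> i + \<beta> i)"
| "growth_weight Separated \<omega> d \<kappa> \<alpha> \<beta> = weight_matrix \<omega> d \<kappa> \<alpha> * weight_matrix \<omega> d \<kappa> \<beta>"

definition S_norm :: "growth \<Rightarrow> (real \<Rightarrow> real) \<Rightarrow> nat \<Rightarrow> real \<Rightarrow> field_fun \<Rightarrow> ennreal" where
  "S_norm G \<omega> d \<kappa> f =
     (SUP \<alpha>\<in>multi_indices d. SUP \<beta>\<in>multi_indices d.
        sup_norm d (\<lambda>x. of_real (monomial d \<alpha> x) * multi_deriv d \<beta> f x)
          / ennreal (growth_weight G \<omega> d \<kappa> \<alpha> \<beta>))"

definition S_step :: "growth \<Rightarrow> (real \<Rightarrow> real) \<Rightarrow> nat \<Rightarrow> real \<Rightarrow> field_fun set" where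
  "S_step G \<omega> d \<kappa> = {f \<in> smooth d. S_norm G \<omega> d \<kappa> f < \<infinity>}"

definition S_step_topology :: "growth \<Rightarrow> (real \<Rightarrow> real) \<Rightarrow> nat \<Rightarrow> real \<Rightarrow> field_fun topology" where
  "S_step_topology G \<omega> d \<kappa> = topology (\<lambda>U. U \<subseteq> S_step G \<omega> d \<kappa> \<and>
     (\<forall>f\<in>U. \<exists>\<epsilon>>0. \<forall>g\<in>S_step G \<omega> d \<kappa>. S_norm G \<omega> d \<kappa> (\<lambda>x. g x - f x) < ennreal \<epsilon> \<longrightarrow> g \<in> U))"

lemma openin_S_step_topology:
  "openin (S_step_topology G \<omega> d \<kappa>) U \<longleftrightarrow> U \<subseteq> S_step G \<omega> d \<kappa> \<and>
     (\<forall>f\<in>U. \<exists>\<epsilon>>0. \<forall>g\<in>S_step G \<omega> d \<kappa>. S_norm G \<omega> d \<kappa> (\<lambda>x. g x - f x) < ennreal \<epsilon> \<longrightarrow> g \<in> U)"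
    (is "_ = ?P U")
proof -
  have inter: "?P (S \<inter> T)" if S: "?P S" and T: "?P T" for S T
  proof (intro conjI ballI)
    show "S \<inter> T \<subseteq> S_step G \<omega> d \<kappa>" using S by blast
    fix f assume f: "f \<in> S \<inter> T"
    obtain e1 where e1: "e1 > 0"
      "\<And>g. g \<in> S_step G \<omega> d \<kappa> \<Longrightarrow> S_norm G \<omega> d \<kappa> (\<lambda>x. g x - f x) < ennreal e1 \<Longrightarrow> g \<in> S"
      using S f by (meson IntD1)
    obtain e2 where e2: "e2 > 0"
      "\<And>g. g \<in> S_step G \<omega> d \<kappa> \<Longrightarrow> S_norm G \<omega> d \<kappa> (\<lambda>x. g x - f x) < ennreal e2 \<Longrightarrow> g \<in> T"
      using T f by (meson IntD2)
    have "\<And>y. y < ennreal (min e1 e2) \<Longrightarrow> y < ennreal e1 \<and> y < ennreal e2"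
      by (meson ennreal_leI min.cobounded1 min.cobounded2 order.strict_trans2)
    then show "\<exists>\<epsilon>>0. \<forall>g\<in>S_step G \<omega> d \<kappa>.
        S_norm G \<omega> d \<kappa> (\<lambda>x. g x - f x) < ennreal \<epsilon> \<longrightarrow> g \<in> S \<inter> T"
      using e1 e2 by (intro exI[of _ "min e1 e2"]) simp
  qed
  have union: "?P (\<Union>K)" if K: "\<And>S. S \<in> K \<Longrightarrow> ?P S" for K
  proof (intro conjI ballI)
    show "\<Union>K \<subseteq> S_step G \<omega> d \<kappa>" using K by blast
    fix f assume "f \<in> \<Union>K"
    then obtain S where S: "S \<in> K" "f \<in> S" by blast
    then obtain e where "e > 0"
      "\<forall>g\<in>S_step G \<omega> d \<kappa>. S_norm G \<omega> d \<kappa> (\<lambda>x. g x - f x) < ennreal e \<longrightarrow> g \<in> S"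
      using K[OF S(1)] by meson
    then show "\<exists>\<epsilon>>0. \<forall>g\<in>S_step G \<omega> d \<kappa>.
        S_norm G \<omega> d \<kappa> (\<lambda>x. g x - f x) < ennreal \<epsilon> \<longrightarrow> g \<in> \<Union>K"
      using S(1) by (intro exI[of _ e]) blast
  qed
  have "istopology ?P"
    unfolding istopology_def
    apply (rule conjI)
     apply (intro allI impI)
     apply (rule inter; assumption)
    apply (intro allI impI)
    apply (rule union)
    apply (erule bspec, assumption)
    done
  then show ?thesis
    unfolding S_step_topology_def by (simp add: topology_inverse')
qed

lemma topspace_S_step_topology: "topspace (S_step_topology G \<omega> d \<kappa>) = S_step G \<omega> d \<kappa>"
proof
  show "topspace (S_step_topology G \<omega> d \<kappa>) \<subseteq> S_step G \<omega> d \<kappa>"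
    using openin_topspace openin_S_step_topology by blast
  have "openin (S_step_topology G \<omega> d \<kappa>) (S_step G \<omega> d \<kappa>)"
    unfolding openin_S_step_topology using zero_less_one by blast
  then show "S_step G \<omega> d \<kappa> \<subseteq> topspace (S_step_topology G \<omega> d \<kappa>)"
    by (rule openin_subset)
qed

definition S_Roumieu :: "growth \<Rightarrow> (real \<Rightarrow> real) \<Rightarrow> nat \<Rightarrow> field_fun set" where
  "S_Roumieu G \<omega> d = {f \<in> smooth d. \<exists>\<kappa>>0. S_norm G \<omega> d \<kappa> f < \<infinity>}"

definition S_Beurling :: "growth \<Rightarrow> (real \<Rightarrow> real) \<Rightarrow> nat \<Rightarrow> field_fun set" where
  "S_Beurling G \<omega> d = {f \<in> smooth d. \<forall>\<kappa>>0. S_norm G \<omega> d \<kappa> f < \<infinity>}"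

definition S_Roumieu_topology :: "growth \<Rightarrow> (real \<Rightarrow> real) \<Rightarrow> nat \<Rightarrow> field_fun topology" where
  "S_Roumieu_topology G \<omega> d = inductive_limit {0<..} (S_step_topology G \<omega> d)"

definition S_Beurling_topology :: "growth \<Rightarrow> (real \<Rightarrow> real) \<Rightarrow> nat \<Rightarrow> field_fun topology" where
  "S_Beurling_topology G \<omega> d = projective_limit {0<..} (S_step_topology G \<omega> d)"

definition continuously_included ::
    "growth \<Rightarrow> growth \<Rightarrow> (real \<Rightarrow> real) \<Rightarrow> (real \<Rightarrow> real) \<Rightarrow> nat \<Rightarrow> bool" where
  "continuously_included G H \<omega> \<sigma> d \<longleftrightarrow>
     S_Roumieu G \<omega> d \<subseteq> S_Beurling H \<sigma> d \<and>
     continuous_map (S_Roumieu_topology G \<omega> d) (S_Beurling_topology H \<sigma> d) (\<lambda>f. f)"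

end

theory Submission
  imports Defs
begin

text \<open>
  Both directions reduce to a norm estimate. Since the Roumieu space carries the locally convex
  inductive topology and the Beurling space the projective one, continuous inclusion means exactly
  that for all parameters \<open>\<kappa>, \<mu> > 0\<close> the norm of index \<open>\<mu>\<close> for \<open>\<sigma>\<close> is bounded by a multiple of the
  norm of index \<open>\<kappa>\<close> for \<open>\<omega>\<close> (\<open>continuously_included_iff\<close>).

  If \<open>\<sigma> = o(\<omega>)\<close>, then \<open>\<sigma> \<le> \<epsilon> \<omega> + K\<close> for every \<open>\<epsilon> > 0\<close>. Conjugation reverses this inequality and
  turns the factor \<open>\<epsilon>\<close> into a change of parameter, so choosing \<open>\<epsilon> = \<mu> / \<kappa>\<close> compares the weight
  sequence of \<open>\<omega>\<close> for any \<open>\<kappa>\<close> with the one of \<open>\<sigma>\<close> for any \<open>\<mu>\<close> (\<open>weight_seq_le_of_smallo\<close>). Joint and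
  separated growth differ only by doubling the parameter, because the Young conjugate is convex and
  superadditive (\<open>growth_weight_le\<close>); this is absorbed in the freedom of \<open>\<kappa>\<close> and \<open>\<mu>\<close>.

  For the converse the norm estimate is tested on the Gaussians \<open>exp (- (t - r)\<^sup>2 / 2)\<close> translated by
  large \<open>r\<close>. Because of \<open>\<omega>(t) = O(t\<^sup>2)\<close>, the weight sequence of \<open>\<omega>\<close> for large \<open>\<kappa>\<close> dominates
  \<open>A\<^sup>n sqrt (n!)\<close> for a prescribed \<open>A\<close>, up to a constant factor, which controls the Gaussian centred
  at the origin; the translation costs powers of \<open>2 r\<close>, that is, a factor \<open>exp (\<omega> (2 r))\<close>
  (\<open>translated_gaussian_S_norm_upper\<close>). On the other hand the translated Gaussian is \<open>1\<close> at \<open>r\<close>, so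
  its norm for \<open>\<sigma>\<close> is at least the supremum over \<open>n\<close> of \<open>r\<^sup>n\<close> divided by the weight sequence.
  That supremum is a discrete biconjugate and hence, by convexity, at least \<open>exp (\<sigma> r / \<mu>) / r\<close>
  (\<open>translated_gaussian_S_norm_lower\<close>). Comparing the two gives
  \<open>\<sigma> r \<le> \<mu> (\<omega> (2 r) + ln r + C)\<close> for every \<open>\<mu> > 0\<close>, with \<open>C\<close> independent of
  \<open>r\<close>, and \<open>\<omega> (2 r) \<le> L (\<omega> r + 1)\<close> and
  \<open>ln r = o(\<omega> r)\<close> turn this into \<open>\<sigma> = o(\<omega>)\<close>.
\<close>

section \<open>The Young conjugate\<close>

text \<open>
  This is where \<open>ln t = o(\<omega>(t))\<close> enters: it says that \<open>\<omega> (exp t)\<close> outgrows every linear function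
  of \<open>t\<close>, so that all the suprema in the definition of the conjugate are finite.
\<close>

lemma young_conjugate_bdd_above:
  assumes "general_weight_function \<omega>"
  shows "bdd_above ((\<lambda>t. t * s - \<omega> (exp t)) ` {0..})"
proof -
  define c where "c = 1 / (\<bar>s\<bar> + 1)"
  have c: "c > 0" by (simp add: c_def add_nonneg_pos)
  have \<omega>0: "0 \<le> \<omega> t" if "t \<ge> 0" for t
    using assms that by (simp add: general_weight_function_def)
  have "ln \<in> o[at_top](\<omega>)" using assms by (simp add: general_weight_function_def)
  from landau_o.smallD[OF this c] obtain T where T: "\<And>u. u \<ge> T \<Longrightarrow> \<bar>ln u\<bar> \<le> c * \<bar>\<omega> u\<bar>"
    by (auto simp: eventually_at_top_linorder)
  have "t * s - \<omega> (exp t) \<le> \<bar>s\<bar> * \<bar>T\<bar>" if "t \<ge> 0" for t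
  proof (cases "exp t \<ge> T")
    case True
    have "t \<le> c * \<omega> (exp t)" using T[OF True] that \<omega>0[of "exp t"] by simp
    then have "(\<bar>s\<bar> + 1) * t \<le> \<omega> (exp t)" by (simp add: c_def field_simps)
    moreover have "t * s \<le> (\<bar>s\<bar> + 1) * t"
      using that by (simp add: mult.commute[of t] mult_right_mono)
    moreover have "0 \<le> \<bar>s\<bar> * \<bar>T\<bar>" by simp
    ultimately show ?thesis by linarith
  next
    case False
    then have "t \<le> \<bar>T\<bar>" using exp_ge_add_one_self[of t] by linarith
    then have "t * s \<le> \<bar>s\<bar> * \<bar>T\<bar>"
      using that by (metis abs_ge_self abs_ge_zero abs_mult abs_of_nonneg mult.commute mult_left_mono order_trans)
    then show ?thesis using \<omega>0[of "exp t"] by simp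
  qed
  then show ?thesis by (auto intro!: bdd_aboveI2)
qed

lemma young_conjugate_upper:
  "general_weight_function \<omega> \<Longrightarrow> 0 \<le> t \<Longrightarrow> t * s - \<omega> (exp t) \<le> young_conjugate \<omega> s"
  unfolding young_conjugate_def by (intro cSUP_upper young_conjugate_bdd_above) auto

lemma young_conjugate_least:
  "(\<And>t. 0 \<le> t \<Longrightarrow> t * s - \<omega> (exp t) \<le> M) \<Longrightarrow> young_conjugate \<omega> s \<le> M"
  unfolding young_conjugate_def by (intro cSUP_least) auto

lemma young_conjugate_mono:
  assumes "general_weight_function \<omega>" "s \<le> s'"
  shows "young_conjugate \<omega> s \<le> young_conjugate \<omega> s'"
proof (rule young_conjugate_least)
  fix t :: real assume t: "0 \<le> t"
  have "t * s \<le> t * s'" using assms(2) t by (rule mult_left_mono)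
  then show "t * s - \<omega> (exp t) \<le> young_conjugate \<omega> s'"
    using young_conjugate_upper[OF assms(1) t, of s'] by linarith
qed

lemma young_conjugate_convex:
  assumes "general_weight_function \<omega>" "0 \<le> u" "0 \<le> v" "u + v = 1"
  shows "young_conjugate \<omega> (u * a + v * b) \<le> u * young_conjugate \<omega> a + v * young_conjugate \<omega> b"
proof (rule young_conjugate_least)
  fix t :: real assume t: "0 \<le> t"
  have "t * (u * a + v * b) - \<omega> (exp t) = u * (t * a - \<omega> (exp t)) + v * (t * b - \<omega> (exp t))"
    using assms(4) by (simp add: algebra_simps flip: distrib_right)
  also have "\<dots> \<le> u * young_conjugate \<omega> a + v * young_conjugate \<omega> b"
    using assms t by (intro add_mono mult_left_mono young_conjugate_upper) auto
  finally show "t * (u * a + v * b) - \<omega> (exp t) \<le> \<dots>" .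
qed

text \<open>
  The value at \<open>0\<close> is \<open>- \<omega> 1\<close>, which need not vanish. Its sign is enough to make the convex conjugate
  subhomogeneous for factors in \<open>[0, 1]\<close> and therefore superadditive.
\<close>

lemma young_conjugate_zero_le:
  "general_weight_function \<omega> \<Longrightarrow> young_conjugate \<omega> 0 \<le> 0"
  by (rule young_conjugate_least) (simp add: general_weight_function_def)

lemma young_conjugate_scale:
  assumes "general_weight_function \<omega>" "0 \<le> u" "u \<le> 1"
  shows "young_conjugate \<omega> (u * a) \<le> u * young_conjugate \<omega> a"
  using young_conjugate_convex[OF assms(1), of u "1 - u" a 0] assms
    mult_nonneg_nonpos[of "1 - u" "young_conjugate \<omega> 0"] young_conjugate_zero_le[OF assms(1)]
  by simp

lemma young_conjugate_superadd:
  assumes "general_weight_function \<omega>" "0 \<le> a" "0 \<le> b"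
  shows "young_conjugate \<omega> a + young_conjugate \<omega> b \<le> young_conjugate \<omega> (a + b)"
proof (cases "a + b = 0")
  case True
  then have "a = 0" "b = 0" using assms by auto
  then show ?thesis using young_conjugate_zero_le[OF assms(1)] by simp
next
  case False
  then have ab: "a + b > 0" using assms by linarith
  let ?y = "young_conjugate \<omega> (a + b)"
  have "young_conjugate \<omega> a \<le> a / (a + b) * ?y"
    using young_conjugate_scale[OF assms(1), of "a / (a + b)" "a + b"] ab assms by simp
  moreover have "young_conjugate \<omega> b \<le> b / (a + b) * ?y"
    using young_conjugate_scale[OF assms(1), of "b / (a + b)" "a + b"] ab assms by simp
  moreover have "a / (a + b) * ?y + b / (a + b) * ?y = ?y"
    using ab by (simp flip: distrib_right add_divide_distrib)
  ultimately show ?thesis by linarith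
qed

section \<open>Comparison of weight sequences\<close>

text \<open>
  The weight matrix depends on a multi-index only through its length. This is the same weight as a
  sequence indexed by that length.
\<close>

definition weight_seq :: "(real \<Rightarrow> real) \<Rightarrow> real \<Rightarrow> nat \<Rightarrow> real" where
  "weight_seq \<omega> \<kappa> n = exp (1 / \<kappa> * young_conjugate \<omega> (\<kappa> * real n))"

lemma weight_seq_pos [simp]: "0 < weight_seq \<omega> \<kappa> n"
  by (simp add: weight_seq_def)

lemma weight_matrix_eq: "weight_matrix \<omega> d \<kappa> \<alpha> = weight_seq \<omega> \<kappa> (\<Sum>i<d. \<alpha> i)"
  by (simp add: weight_matrix_def weight_seq_def)

lemma growth_weight_Joint:
  "growth_weight Joint \<omega> d \<kappa> \<alpha> \<beta> = weight_seq \<omega> \<kappa> ((\<Sum>i<d. \<alpha> i) + (\<Sum>i<d. \<beta> i))"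
  by (simp add: weight_matrix_eq sum.distrib)

lemma growth_weight_Separated:
  "growth_weight Separated \<omega> d \<kappa> \<alpha> \<beta> = weight_seq \<omega> \<kappa> (\<Sum>i<d. \<alpha> i) * weight_seq \<omega> \<kappa> (\<Sum>i<d. \<beta> i)"
  by (simp add: weight_matrix_eq)

declare growth_weight.simps [simp del]

lemma growth_weight_pos: "0 < growth_weight G \<omega> d \<kappa> \<alpha> \<beta>"
  by (cases G) (simp_all add: growth_weight_Joint growth_weight_Separated)

lemma weight_seq_mono_parameter:
  assumes "general_weight_function \<omega>" "0 < \<kappa>" "\<kappa> \<le> \<mu>"
  shows "weight_seq \<omega> \<kappa> n \<le> weight_seq \<omega> \<mu> n"
proof -
  have "young_conjugate \<omega> (\<kappa> * real n) \<le> \<kappa> / \<mu> * young_conjugate \<omega> (\<mu> * real n)"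
    using young_conjugate_scale[OF assms(1), of "\<kappa> / \<mu>" "\<mu> * real n"] assms by simp
  then have "1 / \<kappa> * young_conjugate \<omega> (\<kappa> * real n) \<le> 1 / \<mu> * young_conjugate \<omega> (\<mu> * real n)"
    using assms by (simp add: field_simps)
  then show ?thesis by (simp add: weight_seq_def)
qed

text \<open>
  Convexity at the midpoint of \<open>2 \<kappa> m\<close> and \<open>2 \<kappa> n\<close>. Together with the next lemma, which is
  superadditivity, this makes joint and separated growth interchangeable.
\<close>

lemma weight_seq_add_le:
  assumes "general_weight_function \<omega>" "0 < \<kappa>"
  shows "weight_seq \<omega> \<kappa> (m + n) \<le> weight_seq \<omega> (2 * \<kappa>) m * weight_seq \<omega> (2 * \<kappa>) n"
proof -
  have "young_conjugate \<omega> (\<kappa> * real (m + n)) \<le>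
      1/2 * young_conjugate \<omega> (2 * \<kappa> * real m) + 1/2 * young_conjugate \<omega> (2 * \<kappa> * real n)"
    using young_conjugate_convex[OF assms(1), of "1/2" "1/2" "2 * \<kappa> * real m" "2 * \<kappa> * real n"]
    by (simp add: algebra_simps)
  then show ?thesis using assms(2) by (simp add: weight_seq_def field_simps flip: exp_add)
qed

lemma weight_seq_mult_le:
  assumes "general_weight_function \<omega>" "0 < \<kappa>"
  shows "weight_seq \<omega> \<kappa> m * weight_seq \<omega> \<kappa> n \<le> weight_seq \<omega> \<kappa> (m + n)"
  using young_conjugate_superadd[OF assms(1), of "\<kappa> * real m" "\<kappa> * real n"] assms(2)
  by (simp add: weight_seq_def distrib_left divide_right_mono flip: exp_add add_divide_distrib)

lemma growth_weight_le:
  assumes "general_weight_function \<omega>" "0 < \<kappa>"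
  shows "growth_weight G \<omega> d \<kappa> \<alpha> \<beta> \<le> growth_weight H \<omega> d (2 * \<kappa>) \<alpha> \<beta>"
proof -
  let ?a = "\<Sum>i<d. \<alpha> i" and ?b = "\<Sum>i<d. \<beta> i"
  have mono: "weight_seq \<omega> \<kappa> n \<le> weight_seq \<omega> (2 * \<kappa>) n" for n
    using assms by (intro weight_seq_mono_parameter) auto
  have prod: "weight_seq \<omega> \<kappa> ?a * weight_seq \<omega> \<kappa> ?b \<le> weight_seq \<omega> (2 * \<kappa>) ?a * weight_seq \<omega> (2 * \<kappa>) ?b"
    using mono by (intro mult_mono) (auto intro: less_imp_le)
  show ?thesis
    using mono prod weight_seq_add_le[OF assms, of ?a ?b]
      order_trans[OF weight_seq_mult_le[OF assms, of ?a ?b] mono]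
    by (cases G; cases H) (simp_all add: growth_weight_Joint growth_weight_Separated)
qed

lemma growth_weight_mono_parameter:
  assumes "general_weight_function \<omega>" "0 < \<kappa>" "\<kappa> \<le> \<mu>"
  shows "growth_weight G \<omega> d \<kappa> \<alpha> \<beta> \<le> growth_weight G \<omega> d \<mu> \<alpha> \<beta>"
  by (cases G) (auto simp: growth_weight_Joint growth_weight_Separated less_imp_le
      intro!: mult_mono weight_seq_mono_parameter[OF assms])

text \<open>
  From \<open>\<sigma> \<le> \<epsilon> \<omega> + K\<close> the Young conjugates satisfy \<open>\<epsilon> \<omega>\<^sup>*(s) \<le> \<sigma>\<^sup>*(\<epsilon> s) + K\<close>. With \<open>\<epsilon> = \<mu> / \<kappa>\<close> and
  \<open>s = \<kappa> n\<close> the right-hand side is evaluated at \<open>\<mu> n\<close>, so arbitrary parameters can be compared.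
\<close>

lemma weight_seq_le_of_smallo:
  assumes \<omega>: "general_weight_function \<omega>" and \<sigma>: "general_weight_function \<sigma>"
    and o: "\<sigma> \<in> o[at_top](\<omega>)" and "0 < \<kappa>" "0 < \<mu>"
  obtains C where "0 < C" "\<And>n. weight_seq \<omega> \<kappa> n \<le> C * weight_seq \<sigma> \<mu> n"
proof -
  define \<epsilon> where "\<epsilon> = \<mu> / \<kappa>"
  have \<epsilon>: "0 < \<epsilon>" using assms by (simp add: \<epsilon>_def)
  have nonneg: "0 \<le> \<omega> t" "0 \<le> \<sigma> t" if "0 \<le> t" for t
    using \<omega> \<sigma> that by (auto simp: general_weight_function_def)
  have mono: "mono_on {0..} \<sigma>" using \<sigma> by (simp add: general_weight_function_def)
  obtain T where T: "\<And>u. T \<le> u \<Longrightarrow> \<bar>\<sigma> u\<bar> \<le> \<epsilon> * \<bar>\<omega> u\<bar>"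
    using landau_o.smallD[OF o \<epsilon>] by (auto simp: eventually_at_top_linorder)
  define K where "K = \<sigma> \<bar>T\<bar>"
  have le: "\<sigma> u \<le> \<epsilon> * \<omega> u + K" if "0 \<le> u" for u
  proof (cases "T \<le> u")
    case True
    then show ?thesis using T[OF True] nonneg[OF that] nonneg(2)[of "\<bar>T\<bar>"] by (simp add: K_def)
  next
    case False
    then have "\<sigma> u \<le> K" unfolding K_def using that by (intro mono_onD[OF mono]) auto
    then show ?thesis using \<epsilon> nonneg(1)[OF that] by (simp add: add_increasing)
  qed
  have conj: "young_conjugate \<omega> s \<le> (young_conjugate \<sigma> (\<epsilon> * s) + K) / \<epsilon>" for s
  proof (rule young_conjugate_least)
    fix t :: real assume t: "0 \<le> t"
    have "\<epsilon> * (t * s - \<omega> (exp t)) \<le> t * (\<epsilon> * s) - \<sigma> (exp t) + K"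
      using le[of "exp t"] by (simp add: algebra_simps)
    also have "\<dots> \<le> young_conjugate \<sigma> (\<epsilon> * s) + K"
      using young_conjugate_upper[OF \<sigma> t] by simp
    finally show "t * s - \<omega> (exp t) \<le> (young_conjugate \<sigma> (\<epsilon> * s) + K) / \<epsilon>"
      using \<epsilon> by (simp add: field_simps)
  qed
  show ?thesis
  proof
    show "0 < exp (K / \<mu>)" by simp
    fix n
    have "1 / \<kappa> * young_conjugate \<omega> (\<kappa> * real n) \<le>
        1 / \<kappa> * ((young_conjugate \<sigma> (\<epsilon> * (\<kappa> * real n)) + K) / \<epsilon>)"
      using conj assms by (intro mult_left_mono) auto
    also have "\<dots> = K / \<mu> + 1 / \<mu> * young_conjugate \<sigma> (\<mu> * real n)"
      using assms by (simp add: \<epsilon>_def field_simps)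
    finally show "weight_seq \<omega> \<kappa> n \<le> exp (K / \<mu>) * weight_seq \<sigma> \<mu> n"
      by (simp add: weight_seq_def flip: exp_add)
  qed
qed

lemma growth_weight_le_of_smallo:
  assumes \<omega>: "general_weight_function \<omega>" and \<sigma>: "general_weight_function \<sigma>"
    and "\<sigma> \<in> o[at_top](\<omega>)" and "0 < \<kappa>" "0 < \<mu>"
  obtains C where "0 < C"
    "\<And>\<alpha> \<beta>. growth_weight G \<omega> d \<kappa> \<alpha> \<beta> \<le> C * growth_weight H \<sigma> d \<mu> \<alpha> \<beta>"
proof -
  obtain C where C: "0 < C" "\<And>n. weight_seq \<omega> (2 * \<kappa>) n \<le> C * weight_seq \<sigma> (\<mu> / 2) n"
    using weight_seq_le_of_smallo[OF assms(1-3), of "2 * \<kappa>" "\<mu> / 2"] assms(4,5) by auto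
  have "growth_weight G \<omega> d \<kappa> \<alpha> \<beta> \<le> C * growth_weight H \<sigma> d \<mu> \<alpha> \<beta>" for \<alpha> \<beta>
  proof -
    have "growth_weight G \<omega> d \<kappa> \<alpha> \<beta> \<le> growth_weight Joint \<omega> d (2 * \<kappa>) \<alpha> \<beta>"
      by (rule growth_weight_le[OF \<omega> assms(4)])
    also have "\<dots> \<le> C * growth_weight Joint \<sigma> d (\<mu> / 2) \<alpha> \<beta>"
      by (simp add: growth_weight_Joint C(2))
    also have "\<dots> \<le> C * growth_weight H \<sigma> d \<mu> \<alpha> \<beta>"
      using growth_weight_le[OF \<sigma>, of "\<mu> / 2" Joint d \<alpha> \<beta> H] assms(5) C(1) by simp
    finally show ?thesis .
  qed
  with C(1) show ?thesis by (rule that)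
qed

text \<open>
  One half of the biconjugate theorem for \<open>\<phi>(t) = \<sigma> (exp t)\<close>, restricted to the arguments \<open>\<mu> n\<close>. A
  supporting line of \<open>\<phi>\<close> at \<open>ln r\<close> has a slope \<open>s \<ge> 0\<close> at which the conjugate equals
  \<open>s ln r - \<phi>(ln r)\<close>. Rounding \<open>s / \<mu>\<close> down to an integer \<open>n\<close> loses at most one factor \<open>r\<close>.
\<close>

lemma exp_weight_le_power_div_weight_seq:
  assumes \<sigma>: "general_weight_function \<sigma>" and "0 < \<mu>" "1 < r"
  obtains n where "exp (\<sigma> r / \<mu>) / r \<le> r ^ n / weight_seq \<sigma> \<mu> n"
proof -
  define \<phi> where "\<phi> = (\<lambda>t. \<sigma> (exp t))"
  define t0 where "t0 = ln r"
  have t0: "0 < t0" "exp t0 = r" using assms by (auto simp: t0_def)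
  have cvx: "convex_on {0..} \<phi>"
    using \<sigma> by (simp add: general_weight_function_def \<phi>_def)
  \<comment> \<open>the slope of a supporting line of \<open>\<phi>\<close> at \<open>t0\<close>\<close>
  define s where "s = Inf ((\<lambda>t. (\<phi> t0 - \<phi> t) / (t0 - t)) ` ({t0<..} \<inter> {0..}))"
  have tangent: "\<phi> t0 + s * (t - t0) \<le> \<phi> t" if "0 \<le> t" for t
    using convex_le_Inf_differential[OF cvx, of t0 t] t0(1) that by (simp add: s_def)
  have mono: "mono_on {0..} \<sigma>" using \<sigma> by (simp add: general_weight_function_def)
  have "\<phi> 0 \<le> \<phi> t0" unfolding \<phi>_def using t0 by (intro mono_onD[OF mono]) auto
  then have "0 \<le> s * t0" using tangent[of 0] by simp
  then have s0: "0 \<le> s" using t0(1) by (simp add: zero_le_mult_iff)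
  have ys: "young_conjugate \<sigma> s \<le> t0 * s - \<phi> t0"
    by (rule young_conjugate_least) (use tangent in \<open>simp add: \<phi>_def algebra_simps\<close>)
  define n where "n = nat \<lfloor>s / \<mu>\<rfloor>"
  have n: "real n \<le> s / \<mu>" "s / \<mu> - 1 \<le> real n"
    using s0 assms(2) unfolding n_def by (simp_all add: of_nat_nat)
  have "young_conjugate \<sigma> (\<mu> * real n) \<le> young_conjugate \<sigma> s"
    using n(1) assms(2) by (intro young_conjugate_mono[OF \<sigma>]) (simp add: field_simps)
  then have "1 / \<mu> * young_conjugate \<sigma> (\<mu> * real n) \<le> 1 / \<mu> * (t0 * s - \<phi> t0)"
    using ys assms(2) by (intro mult_left_mono) auto
  moreover have "(s / \<mu> - 1) * t0 \<le> real n * t0"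
    using n(2) t0(1) by (intro mult_right_mono) auto
  ultimately have "\<sigma> r / \<mu> - t0 \<le> real n * t0 - 1 / \<mu> * young_conjugate \<sigma> (\<mu> * real n)"
    using t0 by (simp add: \<phi>_def algebra_simps diff_divide_distrib)
  then have "exp (\<sigma> r / \<mu>) / exp t0 \<le> exp t0 ^ n / weight_seq \<sigma> \<mu> n"
    by (simp add: weight_seq_def flip: exp_diff exp_of_nat_mult)
  then have "exp (\<sigma> r / \<mu>) / r \<le> r ^ n / weight_seq \<sigma> \<mu> n" by (simp add: t0)
  then show ?thesis by (rule that)
qed

text \<open>
  The other, trivial, half of the biconjugate theorem.
\<close>

lemma power_le_weight_seq:
  assumes \<omega>: "general_weight_function \<omega>" and "0 < \<kappa>" "1 \<le> u"
  shows "u ^ n \<le> exp (\<omega> u / \<kappa>) * weight_seq \<omega> \<kappa> n"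
proof -
  have "ln u * (\<kappa> * real n) - \<omega> (exp (ln u)) \<le> young_conjugate \<omega> (\<kappa> * real n)"
    using assms by (intro young_conjugate_upper) auto
  then have "real n * ln u \<le> \<omega> u / \<kappa> + 1 / \<kappa> * young_conjugate \<omega> (\<kappa> * real n)"
    using assms by (simp add: field_simps)
  then have "exp (real n * ln u) \<le> exp (\<omega> u / \<kappa>) * weight_seq \<omega> \<kappa> n"
    by (simp add: weight_seq_def flip: exp_add)
  then show ?thesis using assms by (simp add: exp_of_nat_mult)
qed

text \<open>
  The weight sequence dominates \<open>u\<^sup>n exp (- \<omega> u / \<kappa>)\<close> for every \<open>u \<ge> 1\<close>, and \<open>\<omega> u \<le> K (u\<^sup>2 + 1)\<close>. Taking
  \<open>u\<close> proportional to \<open>sqrt (n + 1)\<close> makes \<open>u\<^sup>n\<close> dominate \<open>sqrt (n!)\<close>, while the exponent stays linear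
  in \<open>n\<close>; if \<open>\<kappa>\<close> is \<open>K\<close> times the square of the proportionality constant, the loss is only
  \<open>exp (n + 2)\<close>.
\<close>

lemma sqrt_fact_le_weight_seq:
  assumes "weight_function \<omega>" "1 \<le> A"
  obtains \<kappa> where "1 \<le> \<kappa>" "\<And>n. A ^ n * sqrt (fact n) \<le> exp 2 * weight_seq \<omega> \<kappa> n"
proof -
  have \<omega>: "general_weight_function \<omega>" and O: "\<omega> \<in> O[at_top](\<lambda>t. t\<^sup>2)"
    using assms by (auto simp: weight_function_def)
  have mono: "mono_on {0..} \<omega>" using \<omega> by (simp add: general_weight_function_def)
  obtain c where c: "c > 0" "eventually (\<lambda>t. norm (\<omega> t) \<le> c * norm (t\<^sup>2)) at_top"
    using O by (elim landau_o.bigE)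
  then obtain T where T: "\<And>t. T \<le> t \<Longrightarrow> \<bar>\<omega> t\<bar> \<le> c * t\<^sup>2"
    by (auto simp: eventually_at_top_linorder)
  define K where "K = max 1 (max c (\<omega> \<bar>T\<bar>))"
  have K: "1 \<le> K" "c \<le> K" "\<omega> \<bar>T\<bar> \<le> K" by (auto simp: K_def)
  have le: "\<omega> t \<le> K * (t\<^sup>2 + 1)" if "0 \<le> t" for t
  proof (cases "T \<le> t")
    case True
    then have "\<omega> t \<le> c * t\<^sup>2" using T[OF True] by simp
    also have "\<dots> \<le> K * (t\<^sup>2 + 1)" using K c by (intro mult_mono) auto
    finally show ?thesis .
  next
    case False
    then have "\<omega> t \<le> \<omega> \<bar>T\<bar>" using that by (intro mono_onD[OF mono]) auto
    also have "\<dots> \<le> K * 1" using K by simp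
    also have "\<dots> \<le> K * (t\<^sup>2 + 1)" using K by (intro mult_left_mono) auto
    finally show ?thesis .
  qed
  \<comment> \<open>the additional factor \<open>exp 1\<close> compensates the loss of \<open>exp n\<close> at the end\<close>
  define B where "B = A * exp 1"
  have B: "1 \<le> B" using assms mult_mono[of 1 A 1 "exp 1"] by (simp add: B_def)
  define \<kappa> where "\<kappa> = K * B\<^sup>2"
  have \<kappa>: "1 \<le> \<kappa>" using K B mult_mono[of 1 K 1 "B\<^sup>2"] by (simp add: \<kappa>_def)
  show ?thesis
  proof (rule that[OF \<kappa>])
    fix n
    \<comment> \<open>\<open>n + 1\<close> instead of \<open>n\<close>, so that \<open>u \<ge> 1\<close> also for \<open>n = 0\<close>\<close>
    define u where "u = B * sqrt (real (n + 1))"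
    have u: "1 \<le> u" using B mult_mono[of 1 B 1 "sqrt (real (n + 1))"] by (simp add: u_def)
    have u2: "u\<^sup>2 = B\<^sup>2 * (real n + 1)" by (simp add: u_def power_mult_distrib)
    have "1 \<le> B\<^sup>2" using B by simp
    then have "u\<^sup>2 + 1 \<le> B\<^sup>2 * (real n + 2)" using u2 by (simp add: algebra_simps)
    then have "K * (u\<^sup>2 + 1) \<le> \<kappa> * (real n + 2)"
      unfolding \<kappa>_def mult.assoc using K by (intro mult_left_mono) auto
    then have "\<omega> u / \<kappa> \<le> real n + 2"
      using le[of u] u \<kappa> by (simp add: field_simps)
    have "fact n \<le> real (n + 1) ^ n"
    proof -
      have "fact n \<le> real (n ^ n)" by (rule fact_le_power)
      also have "\<dots> \<le> real (n + 1) ^ n" unfolding of_nat_power by (intro power_mono) auto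
      finally show ?thesis .
    qed
    then have "sqrt (fact n) \<le> sqrt (real (n + 1)) ^ n"
      by (simp flip: real_sqrt_power)
    then have "B ^ n * sqrt (fact n) \<le> u ^ n"
      using B by (simp add: u_def power_mult_distrib)
    also have "\<dots> \<le> exp (\<omega> u / \<kappa>) * weight_seq \<omega> \<kappa> n"
      using \<kappa> u by (intro power_le_weight_seq[OF \<omega>]) auto
    also have "\<dots> \<le> exp (real n + 2) * weight_seq \<omega> \<kappa> n"
      using \<open>\<omega> u / \<kappa> \<le> real n + 2\<close> by (intro mult_right_mono) (auto intro: less_imp_le)
    finally have "exp 1 ^ n * (A ^ n * sqrt (fact n)) \<le> exp 1 ^ n * (exp 2 * weight_seq \<omega> \<kappa> n)"
      by (simp add: B_def power_mult_distrib exp_add mult_ac flip: exp_of_nat_mult)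
    then show "A ^ n * sqrt (fact n) \<le> exp 2 * weight_seq \<omega> \<kappa> n"
      by simp
  qed
qed

section \<open>Linearity of derivatives of smooth functions\<close>

lemma Euclidean_space_fun_upd:
  "x \<in> topspace (Euclidean_space d) \<Longrightarrow> i < d \<Longrightarrow> x(i := t) \<in> topspace (Euclidean_space d)"
  by (auto simp: topspace_Euclidean_space)

lemma continuous_funs_lincomb:
  assumes "f \<in> continuous_funs d" "g \<in> continuous_funs d"
  shows "(\<lambda>x. a * f x + b * g x) \<in> continuous_funs d"
proof -
  let ?E = "Euclidean_space d"
  have "continuous_map ?E (prod_topology euclidean euclidean) (\<lambda>x. (f x, g x))"
    using assms by (intro continuous_map_pairedI) (simp_all add: continuous_funs_def)
  moreover have "continuous_map (prod_topology euclidean euclidean) euclidean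
      (\<lambda>(u :: complex, v). a * u + b * v)"
    by (auto simp: case_prod_unfold euclidean_product_topology intro!: continuous_intros)
  ultimately have "continuous_map ?E euclidean ((\<lambda>(u, v). a * u + b * v) \<circ> (\<lambda>x. (f x, g x)))"
    by (rule continuous_map_compose)
  then show ?thesis using assms by (simp add: continuous_funs_def o_def)
qed

lemma partial_deriv_lincomb:
  assumes "\<forall>x\<in>topspace (Euclidean_space d). (\<lambda>t. f (x(i := t))) differentiable (at (x i))"
    and "\<forall>x\<in>topspace (Euclidean_space d). (\<lambda>t. g (x(i := t))) differentiable (at (x i))"
  shows "partial_deriv d i (\<lambda>x. a * f x + b * g x) =
    (\<lambda>x. a * partial_deriv d i f x + b * partial_deriv d i g x)"
proof
  fix x
  show "partial_deriv d i (\<lambda>x. a * f x + b * g x) x =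
    a * partial_deriv d i f x + b * partial_deriv d i g x"
  proof (cases "x \<in> topspace (Euclidean_space d)")
    case True
    then have "((\<lambda>t. f (x(i := t))) has_vector_derivative partial_deriv d i f x) (at (x i))"
      and "((\<lambda>t. g (x(i := t))) has_vector_derivative partial_deriv d i g x) (at (x i))"
      using assms by (auto simp: partial_deriv_def simp flip: vector_derivative_works)
    then have "((\<lambda>t. a * f (x(i := t)) + b * g (x(i := t))) has_vector_derivative
        a * partial_deriv d i f x + b * partial_deriv d i g x) (at (x i))"
      by (intro has_vector_derivative_add has_vector_derivative_mult_right)
    then show ?thesis using True by (simp add: partial_deriv_def vector_derivative_at)
  qed (simp add: partial_deriv_def)
qed

lemma Ck_lincomb:
  "f \<in> Ck d k \<Longrightarrow> g \<in> Ck d k \<Longrightarrow> (\<lambda>x. a * f x + b * g x) \<in> Ck d k"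
proof (induction k arbitrary: f g)
  case 0
  then show ?case by (simp add: continuous_funs_lincomb)
next
  case (Suc k)
  then show ?case
    by (auto simp: partial_deriv_lincomb continuous_funs_lincomb
        intro!: differentiable_add differentiable_mult)
qed

lemma smooth_lincomb:
  "f \<in> smooth d \<Longrightarrow> g \<in> smooth d \<Longrightarrow> (\<lambda>x. a * f x + b * g x) \<in> smooth d"
  by (auto simp: smooth_def intro: Ck_lincomb)

lemma smooth_diff: "f \<in> smooth d \<Longrightarrow> g \<in> smooth d \<Longrightarrow> (\<lambda>x. f x - g x) \<in> smooth d"
  using smooth_lincomb[of f d g 1 "-1"] by simp

lemma smooth_cmult: "f \<in> smooth d \<Longrightarrow> (\<lambda>x. c * f x) \<in> smooth d"
  using smooth_lincomb[of f d f c 0] by simp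

lemma smooth_differentiable:
  "f \<in> smooth d \<Longrightarrow> i < d \<Longrightarrow>
     \<forall>x\<in>topspace (Euclidean_space d). (\<lambda>t. f (x(i := t))) differentiable (at (x i))"
  unfolding smooth_def using Ck.simps(2)[of d 0] by blast

lemma smooth_partial_deriv: "f \<in> smooth d \<Longrightarrow> i < d \<Longrightarrow> partial_deriv d i f \<in> smooth d"
  unfolding smooth_def using Ck.simps(2)[of d] by blast

lemma smooth_iterated_partial_deriv:
  "f \<in> smooth d \<Longrightarrow> i < d \<Longrightarrow> (partial_deriv d i ^^ n) f \<in> smooth d"
  by (induction n) (auto intro: smooth_partial_deriv)

lemma smooth_foldr_partial_deriv:
  "f \<in> smooth d \<Longrightarrow> set is \<subseteq> {..<d} \<Longrightarrow> foldr (\<lambda>i. partial_deriv d i ^^ \<beta> i) is f \<in> smooth d"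
  by (induction "is") (auto intro: smooth_iterated_partial_deriv)

lemma iterated_partial_deriv_lincomb:
  assumes "f \<in> smooth d" "g \<in> smooth d" "i < d"
  shows "(partial_deriv d i ^^ n) (\<lambda>x. a * f x + b * g x) =
    (\<lambda>x. a * (partial_deriv d i ^^ n) f x + b * (partial_deriv d i ^^ n) g x)"
proof (induction n)
  case (Suc n)
  have "partial_deriv d i (\<lambda>x. a * (partial_deriv d i ^^ n) f x + b * (partial_deriv d i ^^ n) g x) =
    (\<lambda>x. a * partial_deriv d i ((partial_deriv d i ^^ n) f) x + b * partial_deriv d i ((partial_deriv d i ^^ n) g) x)"
    by (intro partial_deriv_lincomb smooth_differentiable smooth_iterated_partial_deriv assms)
  with Suc show ?case by simp
qed simp

lemma multi_deriv_lincomb: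
  assumes "f \<in> smooth d" "g \<in> smooth d"
  shows "multi_deriv d \<beta> (\<lambda>x. a * f x + b * g x) =
    (\<lambda>x. a * multi_deriv d \<beta> f x + b * multi_deriv d \<beta> g x)"
proof -
  have "foldr (\<lambda>i. partial_deriv d i ^^ \<beta> i) is (\<lambda>x. a * f x + b * g x) =
    (\<lambda>x. a * foldr (\<lambda>i. partial_deriv d i ^^ \<beta> i) is f x +
         b * foldr (\<lambda>i. partial_deriv d i ^^ \<beta> i) is g x)" if "set is \<subseteq> {..<d}" for "is"
    using that assms
    by (induction "is") (simp_all add: iterated_partial_deriv_lincomb smooth_foldr_partial_deriv)
  then show ?thesis by (simp add: multi_deriv_def atLeast_upt)
qed

section \<open>The norms\<close>

text \<open>
  Every estimate of a norm goes through this form, which avoids suprema and extended nonnegative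
  arithmetic.
\<close>

lemma S_norm_le_iff:
  assumes "0 \<le> B"
  shows "S_norm G \<omega> d \<kappa> f \<le> ennreal B \<longleftrightarrow>
    (\<forall>\<alpha>\<in>multi_indices d. \<forall>\<beta>\<in>multi_indices d. \<forall>x\<in>topspace (Euclidean_space d).
       \<bar>monomial d \<alpha> x\<bar> * norm (multi_deriv d \<beta> f x) \<le> B * growth_weight G \<omega> d \<kappa> \<alpha> \<beta>)"
proof -
  have "sup_norm d h / ennreal w \<le> ennreal B \<longleftrightarrow>
      (\<forall>x\<in>topspace (Euclidean_space d). norm (h x) \<le> B * w)" if "0 < w" for h w
  proof -
    have "sup_norm d h / ennreal w = (SUP x\<in>topspace (Euclidean_space d). ennreal (norm (h x) / w))"
      using that by (simp add: sup_norm_def SUP_divide_ennreal divide_ennreal)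
    then show ?thesis
      using that assms by (simp add: SUP_le_iff pos_divide_le_eq)
  qed
  then show ?thesis
    by (simp add: S_norm_def SUP_le_iff growth_weight_pos norm_mult)
qed

lemma S_norm_finiteE:
  assumes "S_norm G \<omega> d \<kappa> f < \<infinity>"
  obtains B where "0 \<le> B" "S_norm G \<omega> d \<kappa> f = ennreal B"
  using assms by (cases "S_norm G \<omega> d \<kappa> f") auto

lemma S_norm_lincomb:
  assumes "f \<in> smooth d" "g \<in> smooth d" "0 \<le> A" "0 \<le> B"
    "S_norm G \<omega> d \<kappa> f \<le> ennreal A" "S_norm G \<omega> d \<kappa> g \<le> ennreal B"
  shows "S_norm G \<omega> d \<kappa> (\<lambda>x. a * f x + b * g x) \<le> ennreal (norm a * A + norm b * B)"
proof (subst S_norm_le_iff, goal_cases)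
  case 1 then show ?case using assms by simp
next
  case 2
  show ?case
  proof (intro ballI)
    fix \<alpha> \<beta> x assume *: "\<alpha> \<in> multi_indices d" "\<beta> \<in> multi_indices d" "x \<in> topspace (Euclidean_space d)"
    let ?w = "growth_weight G \<omega> d \<kappa> \<alpha> \<beta>" and ?m = "\<bar>monomial d \<alpha> x\<bar>"
    have f: "?m * norm (multi_deriv d \<beta> f x) \<le> A * ?w"
      using assms(5) * unfolding S_norm_le_iff[OF assms(3)] by blast
    have g: "?m * norm (multi_deriv d \<beta> g x) \<le> B * ?w"
      using assms(6) * unfolding S_norm_le_iff[OF assms(4)] by blast
    have "?m * norm (a * multi_deriv d \<beta> f x + b * multi_deriv d \<beta> g x) \<le>
        ?m * (norm a * norm (multi_deriv d \<beta> f x) + norm b * norm (multi_deriv d \<beta> g x))"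
      by (intro mult_left_mono norm_triangle_le) (auto simp: norm_mult)
    also have "\<dots> = norm a * (?m * norm (multi_deriv d \<beta> f x)) + norm b * (?m * norm (multi_deriv d \<beta> g x))"
      by (simp add: algebra_simps)
    also have "\<dots> \<le> norm a * (A * ?w) + norm b * (B * ?w)"
      using f g by (intro add_mono mult_left_mono) auto
    finally show "?m * norm (multi_deriv d \<beta> (\<lambda>x. a * f x + b * g x) x) \<le> (norm a * A + norm b * B) * ?w"
      using assms by (simp add: multi_deriv_lincomb algebra_simps)
  qed
qed

lemma S_norm_add_le:
  assumes "f \<in> smooth d" "g \<in> smooth d"
  shows "S_norm G \<omega> d \<kappa> (\<lambda>x. f x + g x) \<le> S_norm G \<omega> d \<kappa> f + S_norm G \<omega> d \<kappa> g"
proof (cases "S_norm G \<omega> d \<kappa> f < \<infinity> \<and> S_norm G \<omega> d \<kappa> g < \<infinity>")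
  case True
  then obtain A B where "0 \<le> A" "S_norm G \<omega> d \<kappa> f = ennreal A" "0 \<le> B" "S_norm G \<omega> d \<kappa> g = ennreal B"
    by (metis S_norm_finiteE)
  then show ?thesis using S_norm_lincomb[OF assms, of A B G \<omega> \<kappa> 1 1] by simp
next
  case False
  then have "S_norm G \<omega> d \<kappa> f + S_norm G \<omega> d \<kappa> g = top"
    by (auto simp: less_top[symmetric] ennreal_add_eq_top)
  then show ?thesis by (metis top_greatest)
qed

lemma S_norm_cmult_le:
  assumes "f \<in> smooth d" "0 \<le> B" "S_norm G \<omega> d \<kappa> f \<le> ennreal B"
  shows "S_norm G \<omega> d \<kappa> (\<lambda>x. c * f x) \<le> ennreal (norm c * B)"
  using S_norm_lincomb[OF assms(1,1,2,2,3,3), of c 0] by simp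

lemma zero_mem_smooth: "(\<lambda>x. 0) \<in> smooth d"
proof -
  have "partial_deriv d i (\<lambda>x. 0) = (\<lambda>x. 0)" for i
    by (simp add: partial_deriv_def fun_eq_iff)
  then have "(\<lambda>x. 0) \<in> Ck d k" for k
    by (induction k) (auto simp: continuous_funs_def)
  then show ?thesis by (simp add: smooth_def)
qed

lemma S_norm_zero: "S_norm G \<omega> d \<kappa> (\<lambda>x. 0) = 0"
proof -
  have "multi_deriv d \<beta> (\<lambda>x. 0) = (\<lambda>x. 0)" for \<beta>
    using multi_deriv_lincomb[OF zero_mem_smooth zero_mem_smooth, of d \<beta> 0 0] by simp
  then have "S_norm G \<omega> d \<kappa> (\<lambda>x. 0) \<le> ennreal 0"
    by (subst S_norm_le_iff) auto
  then show ?thesis by simp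
qed

section \<open>Continuous inclusion as a norm estimate\<close>

lemma S_Roumieu_eq_Union: "S_Roumieu G \<omega> d = (\<Union>\<kappa>\<in>{0<..}. S_step G \<omega> d \<kappa>)"
  by (auto simp: S_Roumieu_def S_step_def)

lemma S_Beurling_eq_Inter: "S_Beurling G \<omega> d = (\<Inter>\<kappa>\<in>{0<..}. S_step G \<omega> d \<kappa>)"
proof (intro equalityI subsetI)
  fix f assume f: "f \<in> (\<Inter>\<kappa>\<in>{0<..}. S_step G \<omega> d \<kappa>)"
  then have "f \<in> S_step G \<omega> d 1" by (rule INT_D) simp
  with f show "f \<in> S_Beurling G \<omega> d" by (simp add: S_Beurling_def S_step_def)
qed (simp add: S_Beurling_def S_step_def)

lemma S_RoumieuE:
  assumes "f \<in> S_Roumieu G \<omega> d"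
  obtains \<kappa> A where "f \<in> smooth d" "0 < \<kappa>" "0 \<le> A" "S_norm G \<omega> d \<kappa> f = ennreal A"
proof -
  obtain \<kappa> where \<kappa>: "f \<in> smooth d" "0 < \<kappa>" "S_norm G \<omega> d \<kappa> f < \<infinity>"
    using assms unfolding S_Roumieu_def by blast
  obtain A where "0 \<le> A" "S_norm G \<omega> d \<kappa> f = ennreal A"
    using \<kappa>(3) by (rule S_norm_finiteE)
  with \<kappa> show ?thesis by (intro that)
qed

text \<open>
  The steps of the inductive limit increase with the parameter. This is what makes their union a
  vector space.
\<close>

lemma S_norm_antimono:
  assumes "general_weight_function \<omega>" "0 < \<kappa>" "\<kappa> \<le> \<mu>" "0 \<le> B" "S_norm G \<omega> d \<kappa> f \<le> ennreal B"
  shows "S_norm G \<omega> d \<mu> f \<le> ennreal B"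
proof -
  have "B * growth_weight G \<omega> d \<kappa> \<alpha> \<beta> \<le> B * growth_weight G \<omega> d \<mu> \<alpha> \<beta>" for \<alpha> \<beta>
    by (intro mult_left_mono growth_weight_mono_parameter assms)
  then show ?thesis
    using assms(5) unfolding S_norm_le_iff[OF assms(4)] by (meson order_trans)
qed

lemma S_Roumieu_lincomb:
  assumes "general_weight_function \<omega>" "f \<in> S_Roumieu G \<omega> d" "g \<in> S_Roumieu G \<omega> d"
  shows "(\<lambda>x. a * f x + b * g x) \<in> S_Roumieu G \<omega> d"
proof -
  obtain \<kappa> A where f: "f \<in> smooth d" "0 < \<kappa>" "0 \<le> A" "S_norm G \<omega> d \<kappa> f = ennreal A"
    using assms(2) by (rule S_RoumieuE)
  obtain \<mu> B where g: "g \<in> smooth d" "0 < \<mu>" "0 \<le> B" "S_norm G \<omega> d \<mu> g = ennreal B"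
    using assms(3) by (rule S_RoumieuE)
  let ?\<nu> = "max \<kappa> \<mu>"
  have "S_norm G \<omega> d ?\<nu> f \<le> ennreal A" "S_norm G \<omega> d ?\<nu> g \<le> ennreal B"
    using S_norm_antimono[OF assms(1) f(2), of ?\<nu> A G d f]
      S_norm_antimono[OF assms(1) g(2), of ?\<nu> B G d g] f g by auto
  then have "S_norm G \<omega> d ?\<nu> (\<lambda>x. a * f x + b * g x) \<le> ennreal (norm a * A + norm b * B)"
    by (intro S_norm_lincomb f g)
  then have "S_norm G \<omega> d ?\<nu> (\<lambda>x. a * f x + b * g x) < \<infinity>"
    by (rule order.strict_trans1) simp
  moreover have "0 < ?\<nu>" using f(2) by simp
  ultimately show ?thesis
    using smooth_lincomb[OF f(1) g(1), of a b] by (auto simp: S_Roumieu_def)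
qed

lemma convex_balanced_S_Roumieu:
  assumes "general_weight_function \<omega>"
  shows "convex_balanced (S_Roumieu G \<omega> d)"
  unfolding convex_balanced_def
proof (intro conjI ballI allI impI)
  show "(\<lambda>x. 0) \<in> S_Roumieu G \<omega> d"
    by (simp add: S_Roumieu_def zero_mem_smooth S_norm_zero gt_ex)
next
  fix f g and u :: real
  assume "f \<in> S_Roumieu G \<omega> d" "g \<in> S_Roumieu G \<omega> d"
  then show "(\<lambda>x. of_real (1 - u) * f x + of_real u * g x) \<in> S_Roumieu G \<omega> d"
    by (rule S_Roumieu_lincomb[OF assms])
next
  fix f and c :: complex assume f: "f \<in> S_Roumieu G \<omega> d"
  have "(\<lambda>x. c * f x + 0 * f x) \<in> S_Roumieu G \<omega> d"
    by (rule S_Roumieu_lincomb[OF assms f f])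
  then show "(\<lambda>x. c * f x) \<in> S_Roumieu G \<omega> d" by simp
qed

lemma openin_S_Roumieu_topology:
  "openin (S_Roumieu_topology G \<omega> d) U \<longleftrightarrow> U \<subseteq> S_Roumieu G \<omega> d \<and>
     (\<forall>f\<in>U. \<exists>V. V \<subseteq> S_Roumieu G \<omega> d \<and> convex_balanced V \<and>
        (\<forall>\<kappa>\<in>{0<..}. openin (S_step_topology G \<omega> d \<kappa>) (V \<inter> S_step G \<omega> d \<kappa>)) \<and>
        (\<forall>g\<in>V. (\<lambda>x. f x + g x) \<in> U))"
  unfolding S_Roumieu_topology_def openin_inductive_limit topspace_S_step_topology S_Roumieu_eq_Union
  by (rule refl)

text \<open>
  The inductive limit topology is given only by its open sets. That the whole union is one of them
  uses the union itself as the neighbourhood \<open>V\<close>, hence that it is convex and balanced.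
\<close>

lemma topspace_S_Roumieu_topology:
  assumes "general_weight_function \<omega>"
  shows "topspace (S_Roumieu_topology G \<omega> d) = S_Roumieu G \<omega> d"
proof
  show "topspace (S_Roumieu_topology G \<omega> d) \<subseteq> S_Roumieu G \<omega> d"
    using openin_S_Roumieu_topology[THEN iffD1, OF openin_topspace] by (rule conjunct1)
  have "S_Roumieu G \<omega> d \<inter> S_step G \<omega> d \<kappa> = S_step G \<omega> d \<kappa>" if "0 < \<kappa>" for \<kappa>
    using that by (auto simp: S_Roumieu_eq_Union)
  then have step: "openin (S_step_topology G \<omega> d \<kappa>) (S_Roumieu G \<omega> d \<inter> S_step G \<omega> d \<kappa>)"
    if "0 < \<kappa>" for \<kappa>
    using openin_topspace[of "S_step_topology G \<omega> d \<kappa>"] that by (simp add: topspace_S_step_topology)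
  have add: "(\<lambda>x. f x + g x) \<in> S_Roumieu G \<omega> d"
    if "f \<in> S_Roumieu G \<omega> d" "g \<in> S_Roumieu G \<omega> d" for f g
    using S_Roumieu_lincomb[OF assms that, of 1 1] by simp
  have "openin (S_Roumieu_topology G \<omega> d) (S_Roumieu G \<omega> d)"
    unfolding openin_S_Roumieu_topology
  proof (intro conjI ballI exI[of _ "S_Roumieu G \<omega> d"])
    show "convex_balanced (S_Roumieu G \<omega> d)" by (rule convex_balanced_S_Roumieu[OF assms])
  next
    fix \<kappa> :: real assume "\<kappa> \<in> {0<..}"
    then show "openin (S_step_topology G \<omega> d \<kappa>) (S_Roumieu G \<omega> d \<inter> S_step G \<omega> d \<kappa>)"
      by (intro step) simp
  next
    fix f g assume "f \<in> S_Roumieu G \<omega> d" "g \<in> S_Roumieu G \<omega> d"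
    then show "(\<lambda>x. f x + g x) \<in> S_Roumieu G \<omega> d" by (rule add)
  qed (rule subset_refl)+
  then show "S_Roumieu G \<omega> d \<subseteq> topspace (S_Roumieu_topology G \<omega> d)"
    by (rule openin_subset)
qed

lemma S_Beurling_topology_eq:
  "S_Beurling_topology G \<omega> d = topology_generated_by
     {U \<inter> S_Beurling G \<omega> d | \<mu> U. 0 < \<mu> \<and> openin (S_step_topology G \<omega> d \<mu>) U}"
  by (simp add: S_Beurling_topology_def projective_limit_def topspace_S_step_topology S_Beurling_eq_Inter)

text \<open>
  A bounded linear inclusion is continuous: the balls of the target norm are open in the source norm.
\<close>

lemma openin_S_norm_ball:
  assumes C: "0 < C" "\<And>f B. f \<in> smooth d \<Longrightarrow> 0 < B \<Longrightarrow> S_norm G \<omega> d \<kappa> f \<le> ennreal B \<Longrightarrow>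
      S_norm H \<sigma> d \<mu> f \<le> ennreal (C * B)"
  shows "openin (S_step_topology G \<omega> d \<kappa>)
    {f \<in> S_step G \<omega> d \<kappa>. S_norm H \<sigma> d \<mu> f < ennreal \<epsilon>}"
  unfolding openin_S_step_topology
proof (intro conjI ballI)
  fix f assume f: "f \<in> {f \<in> S_step G \<omega> d \<kappa>. S_norm H \<sigma> d \<mu> f < ennreal \<epsilon>}"
  then have fs: "f \<in> smooth d" by (simp add: S_step_def)
  obtain A where A: "0 \<le> A" "S_norm H \<sigma> d \<mu> f = ennreal A"
    using f by (elim CollectE conjE, cases "S_norm H \<sigma> d \<mu> f") auto
  then have "A < \<epsilon>" using f by (simp add: ennreal_less_iff)
  define \<delta> where "\<delta> = (\<epsilon> - A) / (2 * C)"
  have \<delta>: "0 < \<delta>" using \<open>A < \<epsilon>\<close> C by (simp add: \<delta>_def)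
  have "S_norm H \<sigma> d \<mu> g < ennreal \<epsilon>"
    if g: "g \<in> S_step G \<omega> d \<kappa>" and less: "S_norm G \<omega> d \<kappa> (\<lambda>x. g x - f x) < ennreal \<delta>" for g
  proof -
    have gs: "g \<in> smooth d" using g by (simp add: S_step_def)
    have "S_norm H \<sigma> d \<mu> g \<le> S_norm H \<sigma> d \<mu> (\<lambda>x. g x - f x) + S_norm H \<sigma> d \<mu> f"
      using S_norm_add_le[OF smooth_diff[OF gs fs] fs] by simp
    also have "\<dots> \<le> ennreal (C * \<delta>) + ennreal A"
      using C(2)[OF smooth_diff[OF gs fs] \<delta>] less A by (intro add_mono) auto
    also have "\<dots> = ennreal (C * \<delta> + A)"
      using C \<delta> A by simp
    also have "\<dots> < ennreal \<epsilon>"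
      using C A \<open>A < \<epsilon>\<close> by (intro ennreal_lessI) (auto simp: \<delta>_def field_simps)
    finally show ?thesis .
  qed
  then show "\<exists>\<delta>>0. \<forall>g\<in>S_step G \<omega> d \<kappa>. S_norm G \<omega> d \<kappa> (\<lambda>x. g x - f x) < ennreal \<delta> \<longrightarrow>
      g \<in> {f \<in> S_step G \<omega> d \<kappa>. S_norm H \<sigma> d \<mu> f < ennreal \<epsilon>}"
    using \<delta> by blast
qed auto

lemma convex_balanced_S_norm_ball:
  assumes "0 < \<epsilon>"
  shows "convex_balanced {f \<in> smooth d. S_norm H \<sigma> d \<mu> f < ennreal \<epsilon>}"
  unfolding convex_balanced_def
proof (intro conjI ballI allI impI)
  show "(\<lambda>x. 0) \<in> {f \<in> smooth d. S_norm H \<sigma> d \<mu> f < ennreal \<epsilon>}"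
    using assms by (simp add: zero_mem_smooth S_norm_zero)
next
  fix f g and u :: real
  assume f: "f \<in> {f \<in> smooth d. S_norm H \<sigma> d \<mu> f < ennreal \<epsilon>}"
    and g: "g \<in> {f \<in> smooth d. S_norm H \<sigma> d \<mu> f < ennreal \<epsilon>}" and u: "u \<in> {0..1}"
  obtain A where A: "0 \<le> A" "S_norm H \<sigma> d \<mu> f = ennreal A" "A < \<epsilon>"
    using f by (elim CollectE conjE, cases "S_norm H \<sigma> d \<mu> f") (auto simp: ennreal_less_iff)
  obtain B where B: "0 \<le> B" "S_norm H \<sigma> d \<mu> g = ennreal B" "B < \<epsilon>"
    using g by (elim CollectE conjE, cases "S_norm H \<sigma> d \<mu> g") (auto simp: ennreal_less_iff)
  have "S_norm H \<sigma> d \<mu> (\<lambda>x. of_real (1 - u) * f x + of_real u * g x) \<le>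
      ennreal (norm (of_real (1 - u) :: complex) * A + norm (of_real u :: complex) * B)"
    using f g A B by (intro S_norm_lincomb) auto
  also have "\<dots> < ennreal \<epsilon>"
    using u A B assms by (intro ennreal_lessI) (auto intro!: convex_bound_lt simp del: of_real_diff)
  finally show "(\<lambda>x. of_real (1 - u) * f x + of_real u * g x) \<in>
      {f \<in> smooth d. S_norm H \<sigma> d \<mu> f < ennreal \<epsilon>}"
    using f g smooth_lincomb[of f d g "of_real (1 - u)" "of_real u"] by simp
next
  fix f and c :: complex
  assume f: "f \<in> {f \<in> smooth d. S_norm H \<sigma> d \<mu> f < ennreal \<epsilon>}" and c: "norm c \<le> 1"
  obtain A where A: "0 \<le> A" "S_norm H \<sigma> d \<mu> f = ennreal A" "A < \<epsilon>"
    using f by (elim CollectE conjE, cases "S_norm H \<sigma> d \<mu> f") (auto simp: ennreal_less_iff)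
  have "S_norm H \<sigma> d \<mu> (\<lambda>x. c * f x) \<le> ennreal (norm c * A)"
    using f A by (intro S_norm_cmult_le) auto
  also have "\<dots> \<le> ennreal A"
    using c A by (intro ennreal_leI mult_left_le_one_le) auto
  also have "\<dots> < ennreal \<epsilon>" using A by (intro ennreal_lessI) auto
  finally show "(\<lambda>x. c * f x) \<in> {f \<in> smooth d. S_norm H \<sigma> d \<mu> f < ennreal \<epsilon>}"
    using f by (simp add: smooth_cmult)
qed

text \<open>
  From the estimate to continuity: the ball of the target norm, cut down to the Roumieu space, is a
  convex balanced set which meets every step in an open set, and its translates are the
  neighbourhoods required by the inductive limit. From continuity to the estimate: the preimage of
  the unit ball of index \<open>\<mu>\<close> contains a ball of some radius \<open>\<epsilon>\<close> of the step of index \<open>\<kappa>\<close>, and the usual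
  rescaling gives the bound \<open>2 / \<epsilon>\<close>. Stating the bound with \<open>B > 0\<close> avoids a separate
  treatment of functions of norm \<open>0\<close>.
\<close>

lemma continuously_included_iff:
  assumes \<omega>: "general_weight_function \<omega>"
  shows "continuously_included G H \<omega> \<sigma> d \<longleftrightarrow>
    (\<forall>\<kappa>>0. \<forall>\<mu>>0. \<exists>C>0. \<forall>f\<in>smooth d. \<forall>B>0.
       S_norm G \<omega> d \<kappa> f \<le> ennreal B \<longrightarrow> S_norm H \<sigma> d \<mu> f \<le> ennreal (C * B))"
    (is "_ \<longleftrightarrow> ?bounded")
proof
  assume ?bounded
  then have bnd: "\<exists>C>0. \<forall>f\<in>smooth d. \<forall>B>0.
       S_norm G \<omega> d \<kappa> f \<le> ennreal B \<longrightarrow> S_norm H \<sigma> d \<mu> f \<le> ennreal (C * B)"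
    if "0 < \<kappa>" "0 < \<mu>" for \<kappa> \<mu>
    using that by blast
  have incl: "S_Roumieu G \<omega> d \<subseteq> S_Beurling H \<sigma> d"
  proof
    fix f assume "f \<in> S_Roumieu G \<omega> d"
    then obtain \<kappa> A where f: "f \<in> smooth d" "0 < \<kappa>" "0 \<le> A" "S_norm G \<omega> d \<kappa> f = ennreal A"
      by (rule S_RoumieuE)
    have "S_norm H \<sigma> d \<mu> f < \<infinity>" if \<mu>: "0 < \<mu>" for \<mu>
    proof -
      obtain C where "\<And>g B. g \<in> smooth d \<Longrightarrow> 0 < B \<Longrightarrow> S_norm G \<omega> d \<kappa> g \<le> ennreal B \<Longrightarrow>
          S_norm H \<sigma> d \<mu> g \<le> ennreal (C * B)"
        using bnd[OF f(2) \<mu>] by blast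
      then have "S_norm H \<sigma> d \<mu> f \<le> ennreal (C * (A + 1))"
        using f by simp
      then show ?thesis by (rule order.strict_trans1) simp
    qed
    then show "f \<in> S_Beurling H \<sigma> d" using f(1) by (simp add: S_Beurling_def)
  qed
  have "continuous_map (S_Roumieu_topology G \<omega> d) (S_Beurling_topology H \<sigma> d) (\<lambda>f. f)"
    unfolding S_Beurling_topology_eq
  proof (rule continuous_on_generated_topo)
    fix W assume "W \<in> {U \<inter> S_Beurling H \<sigma> d | \<mu> U. 0 < \<mu> \<and> openin (S_step_topology H \<sigma> d \<mu>) U}"
    then obtain \<mu> U where W: "W = U \<inter> S_Beurling H \<sigma> d" and \<mu>: "0 < \<mu>"
      and U: "openin (S_step_topology H \<sigma> d \<mu>) U" by blast
    have "openin (S_Roumieu_topology G \<omega> d) (W \<inter> S_Roumieu G \<omega> d)"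
      unfolding openin_S_Roumieu_topology
    proof (intro conjI ballI)
      fix f assume f: "f \<in> W \<inter> S_Roumieu G \<omega> d"
      then have fs: "f \<in> smooth d" by (simp add: S_Roumieu_def)
      have "f \<in> U" using f W by blast
      then obtain \<epsilon> where \<epsilon>: "0 < \<epsilon>" "\<And>g. g \<in> S_step H \<sigma> d \<mu> \<Longrightarrow>
          S_norm H \<sigma> d \<mu> (\<lambda>x. g x - f x) < ennreal \<epsilon> \<Longrightarrow> g \<in> U"
        using U unfolding openin_S_step_topology by meson
      define V where "V = {g \<in> smooth d. S_norm H \<sigma> d \<mu> g < ennreal \<epsilon>} \<inter> S_Roumieu G \<omega> d"
      show "\<exists>V. V \<subseteq> S_Roumieu G \<omega> d \<and> convex_balanced V \<and>
        (\<forall>\<kappa>\<in>{0<..}. openin (S_step_topology G \<omega> d \<kappa>) (V \<inter> S_step G \<omega> d \<kappa>)) \<and>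
        (\<forall>g\<in>V. (\<lambda>x. f x + g x) \<in> W \<inter> S_Roumieu G \<omega> d)"
      proof (intro exI[of _ V] conjI allI impI ballI)
        show "V \<subseteq> S_Roumieu G \<omega> d" by (simp add: V_def)
        show "convex_balanced V" unfolding V_def
          by (intro convex_balanced_Int convex_balanced_S_norm_ball convex_balanced_S_Roumieu \<epsilon> \<omega>)
      next
        fix \<kappa> :: real assume "\<kappa> \<in> {0<..}"
        then have \<kappa>: "0 < \<kappa>" by simp
        obtain C where "0 < C" "\<And>g B. g \<in> smooth d \<Longrightarrow> 0 < B \<Longrightarrow> S_norm G \<omega> d \<kappa> g \<le> ennreal B \<Longrightarrow>
            S_norm H \<sigma> d \<mu> g \<le> ennreal (C * B)"
          using bnd[OF \<kappa> \<mu>] by blast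
        from openin_S_norm_ball[OF this]
        have "openin (S_step_topology G \<omega> d \<kappa>) {f \<in> S_step G \<omega> d \<kappa>. S_norm H \<sigma> d \<mu> f < ennreal \<epsilon>}" .
        also have "{f \<in> S_step G \<omega> d \<kappa>. S_norm H \<sigma> d \<mu> f < ennreal \<epsilon>} = V \<inter> S_step G \<omega> d \<kappa>"
          using \<kappa> by (auto simp: V_def S_Roumieu_def S_step_def)
        finally show "openin (S_step_topology G \<omega> d \<kappa>) (V \<inter> S_step G \<omega> d \<kappa>)" .
      next
        fix g assume g: "g \<in> V"
        then have fg: "(\<lambda>x. f x + g x) \<in> S_Roumieu G \<omega> d"
          using f S_Roumieu_lincomb[OF \<omega>, of f G d g 1 1] by (simp add: V_def)
        then have B: "(\<lambda>x. f x + g x) \<in> S_Beurling H \<sigma> d" using incl by blast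
        then have "(\<lambda>x. f x + g x) \<in> S_step H \<sigma> d \<mu>" using \<mu> by (auto simp: S_Beurling_eq_Inter)
        then have "(\<lambda>x. f x + g x) \<in> U" using g by (intro \<epsilon>(2)) (simp_all add: V_def)
        then show "(\<lambda>x. f x + g x) \<in> W \<inter> S_Roumieu G \<omega> d" using fg B W by blast
      qed
    qed auto
    then show "openin (S_Roumieu_topology G \<omega> d) ((\<lambda>f. f) -` W \<inter> topspace (S_Roumieu_topology G \<omega> d))"
      by (simp add: topspace_S_Roumieu_topology[OF \<omega>])
  next
    have "S_Beurling H \<sigma> d \<in> {U \<inter> S_Beurling H \<sigma> d | \<mu> U. 0 < \<mu> \<and> openin (S_step_topology H \<sigma> d \<mu>) U}"
    proof -
      have "S_Beurling H \<sigma> d = S_step H \<sigma> d 1 \<inter> S_Beurling H \<sigma> d"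
        by (auto simp: S_Beurling_eq_Inter)
      moreover have "openin (S_step_topology H \<sigma> d 1) (S_step H \<sigma> d 1)"
        using openin_topspace[of "S_step_topology H \<sigma> d 1"] by (simp add: topspace_S_step_topology)
      ultimately show ?thesis using zero_less_one by blast
    qed
    then show "(\<lambda>f. f) ` topspace (S_Roumieu_topology G \<omega> d) \<subseteq>
        \<Union>{U \<inter> S_Beurling H \<sigma> d | \<mu> U. 0 < \<mu> \<and> openin (S_step_topology H \<sigma> d \<mu>) U}"
      unfolding topspace_S_Roumieu_topology[OF \<omega>] using incl by auto
  qed
  with incl show "continuously_included G H \<omega> \<sigma> d" by (simp add: continuously_included_def)
next
  assume cont: "continuously_included G H \<omega> \<sigma> d"
  show ?bounded
  proof (intro allI impI)
    fix \<kappa> \<mu> :: real assume \<kappa>: "0 < \<kappa>" and \<mu>: "0 < \<mu>"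
    define W where "W = {f \<in> S_step H \<sigma> d \<mu>. S_norm H \<sigma> d \<mu> f < ennreal 1} \<inter> S_Beurling H \<sigma> d"
    have "openin (S_step_topology H \<sigma> d \<mu>) {f \<in> S_step H \<sigma> d \<mu>. S_norm H \<sigma> d \<mu> f < ennreal 1}"
      by (rule openin_S_norm_ball[of 1]) auto
    then have "openin (S_Beurling_topology H \<sigma> d) W"
      unfolding S_Beurling_topology_eq W_def
      using \<mu> by (intro topology_generated_by_Basis) blast
    then have "openin (S_Roumieu_topology G \<omega> d) {f \<in> topspace (S_Roumieu_topology G \<omega> d). f \<in> W}"
      using cont by (intro openin_continuous_map_preimage) (auto simp: continuously_included_def)
    then have op: "openin (S_Roumieu_topology G \<omega> d) {f \<in> S_Roumieu G \<omega> d. f \<in> W}"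
      by (simp add: topspace_S_Roumieu_topology[OF \<omega>])
    have zero: "(\<lambda>x. 0) \<in> {f \<in> S_Roumieu G \<omega> d. f \<in> W}"
      using \<mu> by (auto simp: W_def S_Roumieu_def S_Beurling_def S_step_def zero_mem_smooth S_norm_zero gt_ex)
    obtain V where V: "convex_balanced V"
        "\<forall>\<kappa>\<in>{0<..}. openin (S_step_topology G \<omega> d \<kappa>) (V \<inter> S_step G \<omega> d \<kappa>)"
        "\<forall>g\<in>V. (\<lambda>x. 0 + g x) \<in> {f \<in> S_Roumieu G \<omega> d. f \<in> W}"
      using bspec[OF conjunct2[OF op[unfolded openin_S_Roumieu_topology]] zero]
      by (elim exE conjE) (rule that)
    have Vo: "openin (S_step_topology G \<omega> d \<kappa>) (V \<inter> S_step G \<omega> d \<kappa>)"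
      using V(2) \<kappa> by simp
    have "(\<lambda>x. 0) \<in> V \<inter> S_step G \<omega> d \<kappa>"
      using V(1) by (auto simp: convex_balanced_def S_step_def zero_mem_smooth S_norm_zero)
    then obtain \<epsilon> where \<epsilon>: "0 < \<epsilon>" "\<And>g. g \<in> S_step G \<omega> d \<kappa> \<Longrightarrow>
        S_norm G \<omega> d \<kappa> (\<lambda>x. g x - 0) < ennreal \<epsilon> \<Longrightarrow> g \<in> V"
      using bspec[OF conjunct2[OF Vo[unfolded openin_S_step_topology]]] by blast
    have "S_norm H \<sigma> d \<mu> f \<le> ennreal (2 / \<epsilon> * B)"
      if f: "f \<in> smooth d" and B: "0 < B" "S_norm G \<omega> d \<kappa> f \<le> ennreal B" for f B
    proof -
      define c where "c = \<epsilon> / (2 * B)"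
      have c: "0 < c" using \<epsilon> B by (simp add: c_def)
      define h where "h = (\<lambda>x. of_real c * f x)"
      have h: "h \<in> smooth d" using f by (simp add: h_def smooth_cmult)
      have "S_norm G \<omega> d \<kappa> h \<le> ennreal (c * B)"
        using S_norm_cmult_le[OF f _ B(2), of "of_real c"] B c by (simp add: h_def)
      also have "\<dots> < ennreal \<epsilon>"
        using B \<epsilon> by (intro ennreal_lessI) (auto simp: c_def)
      finally have less: "S_norm G \<omega> d \<kappa> h < ennreal \<epsilon>" .
      then have "h \<in> S_step G \<omega> d \<kappa>" using h by (auto simp: S_step_def intro: less_trans)
      then have "h \<in> V" using less by (intro \<epsilon>(2)) auto
      then have "S_norm H \<sigma> d \<mu> h \<le> ennreal 1" using V(3) by (auto simp: W_def intro: less_imp_le)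
      then have "S_norm H \<sigma> d \<mu> (\<lambda>x. of_real (1 / c) * h x) \<le> ennreal (1 / c * 1)"
        using S_norm_cmult_le[OF h, of 1 H \<sigma> \<mu> "of_real (1 / c)"] c by (simp add: norm_divide)
      moreover have "(\<lambda>x. of_real (1 / c) * h x) = f" using c by (simp add: h_def)
      ultimately show ?thesis using B \<epsilon> by (simp add: c_def)
    qed
    then show "\<exists>C>0. \<forall>f\<in>smooth d. \<forall>B>0.
       S_norm G \<omega> d \<kappa> f \<le> ennreal B \<longrightarrow> S_norm H \<sigma> d \<mu> f \<le> ennreal (C * B)"
      using \<epsilon>(1) by (intro exI[of _ "2 / \<epsilon>"]) auto
  qed
qed

section \<open>Bounds for the derivatives of the Gaussian\<close>

text \<open>
  The derivatives of \<open>exp (- y\<^sup>2 / 2)\<close>, defined through the three-term recurrence of the Hermite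
  polynomials, from which the bound below is read off.
\<close>

fun gaussian_deriv :: "nat \<Rightarrow> real \<Rightarrow> real" where
  "gaussian_deriv 0 y = exp (- y\<^sup>2 / 2)"
| "gaussian_deriv (Suc 0) y = - y * exp (- y\<^sup>2 / 2)"
| "gaussian_deriv (Suc (Suc n)) y = - y * gaussian_deriv (Suc n) y - real (Suc n) * gaussian_deriv n y"

lemma has_real_derivative_gaussian_deriv:
  "(gaussian_deriv n has_real_derivative gaussian_deriv (Suc n) y) (at y)"
proof (induction n arbitrary: y rule: less_induct)
  case (less n)
  consider "n = 0" | "n = Suc 0" | m where "n = Suc (Suc m)"
    by (metis not0_implies_Suc)
  then show ?case
  proof cases
    case 1
    have "((\<lambda>y::real. exp (- y\<^sup>2 / 2)) has_real_derivative - y * exp (- y\<^sup>2 / 2)) (at y)"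
      by (auto intro!: derivative_eq_intros)
    moreover have "gaussian_deriv 0 = (\<lambda>y. exp (- y\<^sup>2 / 2))" by (simp add: fun_eq_iff)
    ultimately show ?thesis unfolding 1 by simp
  next
    case 2
    have "((\<lambda>y::real. - y * exp (- y\<^sup>2 / 2)) has_real_derivative
        - y * (- y * exp (- y\<^sup>2 / 2)) - exp (- y\<^sup>2 / 2)) (at y)"
      by (auto intro!: derivative_eq_intros)
    moreover have "gaussian_deriv (Suc 0) = (\<lambda>y. - y * exp (- y\<^sup>2 / 2))" by (simp add: fun_eq_iff)
    ultimately show ?thesis unfolding 2 by simp
  next
    case (3 m)
    have "((\<lambda>y. - y * gaussian_deriv (Suc m) y - real (Suc m) * gaussian_deriv m y) has_real_derivative
       - y * gaussian_deriv (Suc (Suc m)) y - real (Suc (Suc m)) * gaussian_deriv (Suc m) y) (at y)"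
      using less.IH[of m y] less.IH[of "Suc m" y] 3
      by (auto intro!: derivative_eq_intros simp: algebra_simps simp del: gaussian_deriv.simps)
    moreover have "gaussian_deriv (Suc (Suc m)) =
        (\<lambda>y. - y * gaussian_deriv (Suc m) y - real (Suc m) * gaussian_deriv m y)"
      by (simp add: fun_eq_iff)
    ultimately show ?thesis unfolding 3 by simp
  qed
qed

lemma power_le_fact_mult_exp:
  fixes x :: real assumes "0 \<le> x" shows "x ^ n \<le> fact n * exp x"
proof -
  have "(\<Sum>k\<in>{n}. inverse (fact k) * x ^ k) \<le> (\<Sum>k. inverse (fact k) * x ^ k)"
    using assms by (intro sum_le_suminf summable_exp) auto
  then have "inverse (fact n) * x ^ n \<le> exp x" by (simp add: exp_def)
  then show ?thesis by (simp add: field_simps)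
qed

text \<open>
  For \<open>b = 0\<close> the square of this is \<open>y\<^sup>2\<^sup>a \<le> a! exp (y\<^sup>2)\<close>. In the recurrence the first
  term shifts one unit from \<open>b\<close> to \<open>a\<close>, and in the second one the factor \<open>n + 1\<close> is absorbed in passing from \<open>sqrt ((a + n)!)\<close> to
  \<open>sqrt ((a + n + 2)!)\<close>; so each derivative at most doubles the bound.
\<close>

lemma gaussian_deriv_bound: "\<bar>y\<bar> ^ a * \<bar>gaussian_deriv b y\<bar> \<le> 2 ^ b * sqrt (fact (a + b))"
proof -
  have base: "\<bar>y\<bar> ^ a * exp (- y\<^sup>2 / 2) \<le> sqrt (fact a)" for a
  proof (rule real_le_rsqrt)
    have "(y\<^sup>2) ^ a \<le> fact a * exp (y\<^sup>2)" by (rule power_le_fact_mult_exp) simp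
    then have "(y\<^sup>2) ^ a * exp (- (y\<^sup>2)) \<le> fact a" by (simp add: exp_minus field_simps)
    moreover have "(exp (- y\<^sup>2 / 2))\<^sup>2 = exp (- (y\<^sup>2))"
      by (simp flip: exp_of_nat_mult)
    moreover have "(\<bar>y\<bar> ^ a)\<^sup>2 = (y\<^sup>2) ^ a"
      by (metis power2_abs power_mult mult.commute)
    ultimately show "(\<bar>y\<bar> ^ a * exp (- y\<^sup>2 / 2))\<^sup>2 \<le> fact a"
      by (simp add: power_mult_distrib)
  qed
  show ?thesis
  proof (induction b arbitrary: a rule: less_induct)
    case (less b)
    consider "b = 0" | "b = Suc 0" | n where "b = Suc (Suc n)"
      by (metis not0_implies_Suc)
    then show ?case
    proof cases
      case 1
      then show ?thesis using base[of a] by simp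
    next
      case 2
      have "\<bar>y\<bar> ^ a * \<bar>gaussian_deriv b y\<bar> = \<bar>y\<bar> ^ Suc a * exp (- y\<^sup>2 / 2)"
        by (simp add: 2 abs_mult)
      also have "\<dots> \<le> sqrt (fact (Suc a))" by (rule base)
      also have "\<dots> \<le> 2 * sqrt (fact (Suc a))"
        using mult_right_mono[of 1 2 "sqrt (fact (Suc a))"] by (simp del: fact_Suc)
      finally show ?thesis by (simp add: 2 del: fact_Suc)
    next
      case (3 n)
      let ?g = "\<lambda>k. \<bar>gaussian_deriv k y\<bar>"
      have "real (Suc n) * sqrt (fact (a + n)) \<le> sqrt (fact (a + b))"
      proof (rule real_le_rsqrt)
        have "(real (Suc n))\<^sup>2 \<le> real (Suc (Suc (a + n))) * real (Suc (a + n))"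
          unfolding power2_eq_square by (intro mult_mono) auto
        then have "(real (Suc n))\<^sup>2 * fact (a + n) \<le>
            real (Suc (Suc (a + n))) * real (Suc (a + n)) * fact (a + n)"
          by (intro mult_right_mono) auto
        then show "(real (Suc n) * sqrt (fact (a + n)))\<^sup>2 \<le> fact (a + b)"
          by (simp add: 3 power_mult_distrib mult.assoc)
      qed
      then have fact: "2 ^ n * (real (Suc n) * sqrt (fact (a + n))) \<le> 2 ^ n * sqrt (fact (a + b))"
        by simp
      have "?g b \<le> \<bar>y\<bar> * ?g (Suc n) + real (Suc n) * ?g n"
        unfolding 3 gaussian_deriv.simps(3)
        by (rule order_trans[OF abs_triangle_ineq4]) (simp add: abs_mult)
      then have "\<bar>y\<bar> ^ a * ?g b \<le> \<bar>y\<bar> ^ a * (\<bar>y\<bar> * ?g (Suc n) + real (Suc n) * ?g n)"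
        by (intro mult_left_mono) auto
      also have "\<dots> = \<bar>y\<bar> ^ Suc a * ?g (Suc n) + real (Suc n) * (\<bar>y\<bar> ^ a * ?g n)"
        by (simp add: algebra_simps)
      also have "\<dots> \<le> 2 ^ Suc n * sqrt (fact (Suc a + Suc n)) + real (Suc n) * (2 ^ n * sqrt (fact (a + n)))"
        using less.IH[of "Suc n" "Suc a"] less.IH[of n a] 3 by (intro add_mono mult_left_mono) auto
      also have "\<dots> \<le> 2 ^ Suc n * sqrt (fact (a + b)) + 2 ^ n * sqrt (fact (a + b))"
        using fact by (simp add: 3 mult_ac del: fact_Suc)
      also have "\<dots> \<le> 2 ^ b * sqrt (fact (a + b))"
        by (simp add: 3 del: fact_Suc flip: distrib_right)
      finally show ?thesis .
    qed
  qed
qed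

lemma sqrt_fact_add_le: "sqrt (fact (a + b)) \<le> 2 ^ (a + b) * (sqrt (fact a) * sqrt (fact b))"
proof -
  have "fact (a + b) = real (fact a * fact b * ((a + b) choose a))"
    using binomial_fact_lemma[of a "a + b"] by (metis add_diff_cancel_left' le_add1 of_nat_fact)
  also have "\<dots> \<le> real (fact a * fact b * 2 ^ (a + b))"
    unfolding of_nat_le_iff by (intro mult_left_mono binomial_le_pow2) auto
  also have "\<dots> \<le> fact a * fact b * (2 ^ (a + b))\<^sup>2"
    by (simp add: power2_eq_square)
  finally have "sqrt (fact (a + b)) \<le> sqrt (fact a * fact b * (2 ^ (a + b))\<^sup>2)"
    by simp
  then show ?thesis by (simp add: real_sqrt_mult mult_ac)
qed

lemma power_add_le:
  fixes p q :: real
  assumes "0 \<le> p" "0 \<le> q"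
  shows "(p + q) ^ n \<le> 2 ^ n * (p ^ n + q ^ n)"
proof -
  have "(p + q) ^ n \<le> (2 * max p q) ^ n" using assms by (intro power_mono) auto
  also have "\<dots> \<le> 2 ^ n * (p ^ n + q ^ n)"
    using assms by (simp add: power_mult_distrib max_def)
  finally show ?thesis .
qed

section \<open>Translated Gaussians as functions on one-dimensional space\<close>

text \<open>
  The points of one-dimensional space are sequences supported at \<open>0\<close>; a function of one real variable
  becomes a function of the entry at \<open>0\<close>, extended by \<open>0\<close> off the space.
\<close>

definition line_fun :: "(real \<Rightarrow> real) \<Rightarrow> field_fun" where
  "line_fun g x = (if x \<in> topspace (Euclidean_space 1) then of_real (g (x 0)) else 0)"

lemma line_fun_continuous:
  assumes "continuous_on UNIV g"
  shows "line_fun g \<in> continuous_funs 1"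
proof -
  have "continuous_map (Euclidean_space 1) euclideanreal (\<lambda>x. x 0)"
    unfolding Euclidean_space_def
    by (intro continuous_map_from_subtopology continuous_map_product_projection) simp
  moreover have "continuous_map euclideanreal euclidean (\<lambda>t. complex_of_real (g t))"
    using assms by (auto intro!: continuous_intros)
  ultimately have "continuous_map (Euclidean_space 1) euclidean ((\<lambda>t. complex_of_real (g t)) \<circ> (\<lambda>x. x 0))"
    by (rule continuous_map_compose)
  then have "continuous_map (Euclidean_space 1) euclidean (line_fun g)"
    by (rule continuous_map_eq) (simp add: line_fun_def)
  then show ?thesis by (simp add: continuous_funs_def line_fun_def)
qed

lemma line_fun_has_vector_derivative:
  assumes "\<And>t. (g has_real_derivative g' t) (at t)" "x \<in> topspace (Euclidean_space 1)"
  shows "((\<lambda>t. line_fun g (x(0 := t))) has_vector_derivative line_fun g' x) (at (x 0))"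
proof -
  have "(\<lambda>t. line_fun g (x(0 := t))) = (\<lambda>t. of_real (g t))"
    using assms(2) Euclidean_space_fun_upd[OF assms(2), of 0] by (simp add: line_fun_def)
  then show ?thesis
    using has_vector_derivative_of_real[OF assms(1)] assms(2) by (simp add: line_fun_def)
qed

lemma partial_deriv_line_fun:
  assumes "\<And>t. (g has_real_derivative g' t) (at t)"
  shows "partial_deriv 1 0 (line_fun g) = line_fun g'"
proof
  fix x
  show "partial_deriv 1 0 (line_fun g) x = line_fun g' x"
    using line_fun_has_vector_derivative[OF assms, of x]
    by (cases "x \<in> topspace (Euclidean_space 1)")
      (simp_all add: partial_deriv_def vector_derivative_at, simp add: line_fun_def)
qed

lemma line_fun_smooth:
  assumes "\<And>n t. (g n has_real_derivative g (Suc n) t) (at t)"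
  shows "line_fun (g n) \<in> smooth 1"
proof -
  have "continuous_on UNIV (g n)" for n
    using assms by (meson DERIV_isCont continuous_at_imp_continuous_on)
  then have cont: "line_fun (g n) \<in> continuous_funs 1" for n by (rule line_fun_continuous)
  have "line_fun (g n) \<in> Ck 1 k" for k
  proof (induction k arbitrary: n)
    case (Suc k)
    have "(\<lambda>t. line_fun (g n) (x(0 := t))) differentiable (at (x 0))"
      if "x \<in> topspace (Euclidean_space 1)" for x
      using line_fun_has_vector_derivative[OF assms that] by (rule differentiableI_vector)
    then show ?case
      using Suc cont partial_deriv_line_fun[OF assms] by (simp del: One_nat_def)
  qed (simp add: cont del: One_nat_def)
  then show ?thesis by (simp add: smooth_def)
qed

lemma multi_deriv_line_fun:
  assumes "\<And>n t. (g n has_real_derivative g (Suc n) t) (at t)"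
  shows "multi_deriv 1 \<beta> (line_fun (g 0)) = line_fun (g (\<beta> 0))"
proof -
  have "(partial_deriv 1 0 ^^ k) (line_fun (g 0)) = line_fun (g k)" for k
    by (induction k) (simp_all add: partial_deriv_line_fun[OF assms] del: One_nat_def)
  moreover have "[0..<1] = [0]" by simp
  ultimately show ?thesis by (simp add: multi_deriv_def del: One_nat_def)
qed

definition translated_gaussian :: "real \<Rightarrow> nat \<Rightarrow> real \<Rightarrow> real" where
  "translated_gaussian r n t = gaussian_deriv n (t - r)"

lemma translated_gaussian_deriv:
  "(translated_gaussian r n has_real_derivative translated_gaussian r (Suc n) t) (at t)"
  unfolding translated_gaussian_def
proof -
  have "((\<lambda>t. t - r) has_real_derivative 1) (at t)"
    by (auto intro!: derivative_eq_intros)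
  from DERIV_chain2[OF has_real_derivative_gaussian_deriv this]
  show "((\<lambda>t. gaussian_deriv n (t - r)) has_real_derivative gaussian_deriv (Suc n) (t - r)) (at t)"
    by simp
qed

text \<open>
  With \<open>y = x - r\<close> the power \<open>x\<^sup>a\<close> splits into \<open>y\<^sup>a\<close> and \<open>r\<^sup>a\<close>, up to \<open>2\<^sup>a\<close>. The first part is bounded
  independently of \<open>r\<close>: the powers of \<open>2\<close> from the splitting, from the Gaussian bound and from separating
  \<open>(a + b)!\<close> combine to \<open>4\<^sup>a\<^sup>+\<^sup>b\<close>, which the weight sequence absorbs for a suitable \<open>\<kappa>\<close>. In the second
  part \<open>(2 r)\<^sup>a\<close> costs \<open>exp (\<omega> (2 r) / \<kappa>)\<close>. The resulting bound is by separated weights, which are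
  below the joint ones.
\<close>

lemma translated_gaussian_S_norm_upper:
  assumes "weight_function \<omega>"
  obtains \<kappa> C where "0 < \<kappa>" "0 < C"
    "\<And>r. 1 \<le> r \<Longrightarrow> S_norm G \<omega> 1 \<kappa> (line_fun (translated_gaussian r 0)) \<le> ennreal (C * exp (\<omega> (2 * r)))"
proof -
  have \<omega>: "general_weight_function \<omega>" using assms by (simp add: weight_function_def)
  obtain \<kappa> where \<kappa>: "1 \<le> \<kappa>" and W: "\<And>n. 4 ^ n * sqrt (fact n) \<le> exp 2 * weight_seq \<omega> \<kappa> n"
    using sqrt_fact_le_weight_seq[OF assms, of 4] by auto
  define w where "w = weight_seq \<omega> \<kappa>"
  have w: "0 < w n" for n by (simp add: w_def)
  have bound: "\<bar>x\<bar> ^ a * \<bar>gaussian_deriv b (x - r)\<bar> \<le> 2 * exp 4 * exp (\<omega> (2 * r)) * (w a * w b)"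
    if r: "1 \<le> r" for r x a b
  proof -
    define y where "y = x - r"
    let ?g = "\<bar>gaussian_deriv b y\<bar>"
    have g: "?g \<le> 2 ^ b * sqrt (fact b)" using gaussian_deriv_bound[of y 0 b] by simp
    have \<omega>0: "0 \<le> \<omega> (2 * r)" using \<omega> r by (simp add: general_weight_function_def)
    have "2 ^ a * (\<bar>y\<bar> ^ a * ?g) \<le> 2 ^ a * (2 ^ b * sqrt (fact (a + b)))"
      by (intro mult_left_mono gaussian_deriv_bound) auto
    also have "\<dots> \<le> 2 ^ a * (2 ^ b * (2 ^ (a + b) * (sqrt (fact a) * sqrt (fact b))))"
      by (intro mult_left_mono sqrt_fact_add_le) auto
    also have "\<dots> = (4 ^ a * sqrt (fact a)) * (4 ^ b * sqrt (fact b))"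
      by (simp add: power_add mult_ac flip: power_mult_distrib)
    also have "\<dots> \<le> (exp 2 * w a) * (exp 2 * w b)"
      unfolding w_def by (rule mult_mono[OF W W]) (simp_all add: less_imp_le)
    also have "\<dots> = exp 4 * (w a * w b)"
      by (simp add: mult_ac flip: exp_add mult.assoc)
    also have "\<dots> \<le> exp 4 * exp (\<omega> (2 * r)) * (w a * w b)"
      using \<omega>0 w[of a] w[of b] by simp
    finally have 1: "2 ^ a * (\<bar>y\<bar> ^ a * ?g) \<le> exp 4 * exp (\<omega> (2 * r)) * (w a * w b)" .
    have "(2 * r) ^ a \<le> exp (\<omega> (2 * r) / \<kappa>) * w a"
      unfolding w_def using r \<kappa> by (intro power_le_weight_seq[OF \<omega>]) auto
    also have "\<dots> \<le> exp (\<omega> (2 * r)) * w a"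
      using \<kappa> \<omega>0 w[of a] mult_left_mono[of 1 \<kappa> "\<omega> (2 * r)"] by (simp add: divide_le_eq)
    finally have ra: "(2 * r) ^ a \<le> exp (\<omega> (2 * r)) * w a" .
    have "2 ^ b * sqrt (fact b) \<le> 4 ^ b * sqrt (fact b)"
      by (intro mult_right_mono power_mono) auto
    also have "\<dots> \<le> exp 2 * w b"
      unfolding w_def by (rule W)
    also have "\<dots> \<le> exp 4 * w b"
      using w[of b] by simp
    finally have "?g \<le> exp 4 * w b" using g by linarith
    then have "(2 * r) ^ a * ?g \<le> (exp (\<omega> (2 * r)) * w a) * (exp 4 * w b)"
      using ra w[of a] by (intro mult_mono) auto
    then have 2: "2 ^ a * (r ^ a * ?g) \<le> exp 4 * exp (\<omega> (2 * r)) * (w a * w b)"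
      by (simp add: power_mult_distrib mult_ac)
    have "\<bar>x\<bar> ^ a \<le> (\<bar>y\<bar> + r) ^ a" using r by (intro power_mono) (auto simp: y_def)
    also have "\<dots> \<le> 2 ^ a * (\<bar>y\<bar> ^ a + r ^ a)" using r by (intro power_add_le) auto
    finally have "\<bar>x\<bar> ^ a * ?g \<le> 2 ^ a * (\<bar>y\<bar> ^ a + r ^ a) * ?g"
      by (rule mult_right_mono) auto
    then show ?thesis using 1 2 by (simp add: algebra_simps y_def)
  qed
  have gw: "w (\<alpha> 0) * w (\<beta> 0) \<le> growth_weight G \<omega> 1 \<kappa> \<alpha> \<beta>" for \<alpha> \<beta>
    using weight_seq_mult_le[OF \<omega>, of \<kappa>] \<kappa>
    by (cases G) (auto simp: growth_weight_Joint growth_weight_Separated w_def)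
  show ?thesis
  proof
    show "0 < \<kappa>" using \<kappa> by simp
    show "0 < 2 * exp (4::real)" by simp
    fix r :: real assume r: "1 \<le> r"
    have "\<bar>monomial 1 \<alpha> x\<bar> * norm (multi_deriv 1 \<beta> (line_fun (translated_gaussian r 0)) x)
      \<le> 2 * exp 4 * exp (\<omega> (2 * r)) * growth_weight G \<omega> 1 \<kappa> \<alpha> \<beta>"
      if "x \<in> topspace (Euclidean_space 1)" for \<alpha> \<beta> x
    proof -
      have "\<bar>monomial 1 \<alpha> x\<bar> * norm (multi_deriv 1 \<beta> (line_fun (translated_gaussian r 0)) x)
        = \<bar>x 0\<bar> ^ \<alpha> 0 * \<bar>gaussian_deriv (\<beta> 0) (x 0 - r)\<bar>"
        using that unfolding multi_deriv_line_fun[of "translated_gaussian r", OF translated_gaussian_deriv]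
        by (simp add: monomial_def line_fun_def translated_gaussian_def power_abs)
      also have "\<dots> \<le> 2 * exp 4 * exp (\<omega> (2 * r)) * (w (\<alpha> 0) * w (\<beta> 0))"
        by (rule bound[OF r])
      also have "\<dots> \<le> 2 * exp 4 * exp (\<omega> (2 * r)) * growth_weight G \<omega> 1 \<kappa> \<alpha> \<beta>"
        by (intro mult_left_mono gw) auto
      finally show ?thesis .
    qed
    then show "S_norm G \<omega> 1 \<kappa> (line_fun (translated_gaussian r 0)) \<le> ennreal (2 * exp 4 * exp (\<omega> (2 * r)))"
      by (subst S_norm_le_iff) auto
  qed
qed

text \<open>
  The supremum is bounded from below by its value at the point \<open>r\<close>, without derivatives, and with the
  power \<open>n\<close> which is optimal for \<open>\<sigma>\<close> up to rounding.
\<close>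

lemma translated_gaussian_S_norm_lower:
  assumes \<sigma>: "general_weight_function \<sigma>" and "0 < \<mu>" "1 < r" "0 \<le> B"
    and le: "S_norm H \<sigma> 1 \<mu> (line_fun (translated_gaussian r 0)) \<le> ennreal B"
  shows "exp (\<sigma> r / \<mu>) \<le> B * r"
proof -
  obtain n where n: "exp (\<sigma> r / \<mu>) / r \<le> r ^ n / weight_seq \<sigma> \<mu> n"
    using exp_weight_le_power_div_weight_seq[OF assms(1-3)] .
  define x :: "nat \<Rightarrow> real" where "x = (\<lambda>i. if i = 0 then r else 0)"
  define \<alpha> :: "nat \<Rightarrow> nat" where "\<alpha> = (\<lambda>i. if i = 0 then n else 0)"
  have x: "x \<in> topspace (Euclidean_space 1)" by (simp add: x_def topspace_Euclidean_space)
  have \<alpha>: "\<alpha> \<in> multi_indices 1" "(\<lambda>i. 0) \<in> multi_indices 1"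
    by (simp_all add: \<alpha>_def multi_indices_def)
  have "\<bar>monomial 1 \<alpha> x\<bar> * norm (multi_deriv 1 (\<lambda>i. 0) (line_fun (translated_gaussian r 0)) x)
      \<le> B * growth_weight H \<sigma> 1 \<mu> \<alpha> (\<lambda>i. 0)"
    using le \<alpha> x unfolding S_norm_le_iff[OF assms(4)] by blast
  moreover have "\<bar>monomial 1 \<alpha> x\<bar> * norm (multi_deriv 1 (\<lambda>i. 0) (line_fun (translated_gaussian r 0)) x) = r ^ n"
    using x assms(3) unfolding multi_deriv_line_fun[of "translated_gaussian r", OF translated_gaussian_deriv]
    by (simp add: monomial_def line_fun_def translated_gaussian_def) (simp add: x_def \<alpha>_def)
  moreover have "growth_weight H \<sigma> 1 \<mu> \<alpha> (\<lambda>i. 0) \<le> weight_seq \<sigma> \<mu> n"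
    using weight_seq_mult_le[OF \<sigma> assms(2), of n 0]
    by (cases H) (simp_all add: growth_weight_Joint growth_weight_Separated \<alpha>_def)
  ultimately have "r ^ n \<le> B * weight_seq \<sigma> \<mu> n"
    using assms(4) by (metis mult_left_mono order_trans)
  then have "r ^ n / weight_seq \<sigma> \<mu> n \<le> B" by (simp add: pos_divide_le_eq)
  then have "exp (\<sigma> r / \<mu>) / r \<le> B" using n by linarith
  then show ?thesis using assms(3) by (simp add: pos_divide_le_eq)
qed

section \<open>The inclusion theorem\<close>

lemma continuously_included_of_smallo:
  assumes \<omega>: "general_weight_function \<omega>" and \<sigma>: "general_weight_function \<sigma>"
    and o: "\<sigma> \<in> o[at_top](\<omega>)"
  shows "continuously_included G H \<omega> \<sigma> d"
  unfolding continuously_included_iff[OF \<omega>]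
proof (intro allI impI)
  fix \<kappa> \<mu> :: real assume "0 < \<kappa>" "0 < \<mu>"
  then obtain C where C: "0 < C"
    "\<And>\<alpha> \<beta>. growth_weight G \<omega> d \<kappa> \<alpha> \<beta> \<le> C * growth_weight H \<sigma> d \<mu> \<alpha> \<beta>"
    using growth_weight_le_of_smallo[OF assms] by metis
  have "S_norm H \<sigma> d \<mu> f \<le> ennreal (C * B)" if "0 < B" "S_norm G \<omega> d \<kappa> f \<le> ennreal B" for f B
  proof -
    have "B * growth_weight G \<omega> d \<kappa> \<alpha> \<beta> \<le> C * B * growth_weight H \<sigma> d \<mu> \<alpha> \<beta>" for \<alpha> \<beta>
      using C(2)[of \<alpha> \<beta>] that(1) by (simp add: mult.assoc mult.left_commute)
    moreover have "0 \<le> B" "0 \<le> C * B" using C that by auto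
    ultimately show ?thesis
      using that(2) by (simp only: S_norm_le_iff) (meson order_trans)
  qed
  then show "\<exists>C>0. \<forall>f\<in>smooth d. \<forall>B>0.
      S_norm G \<omega> d \<kappa> f \<le> ennreal B \<longrightarrow> S_norm H \<sigma> d \<mu> f \<le> ennreal (C * B)"
    using C(1) by blast
qed

lemma smallo_of_continuously_included:
  assumes \<omega>: "weight_function \<omega>" and \<sigma>: "general_weight_function \<sigma>"
    and incl: "continuously_included G H \<omega> \<sigma> 1"
  shows "\<sigma> \<in> o[at_top](\<omega>)"
proof (rule landau_o.smallI)
  fix c :: real assume c: "0 < c"
  have g\<omega>: "general_weight_function \<omega>" using \<omega> by (simp add: weight_function_def)
  then obtain L where L: "1 \<le> L" "\<And>t. 0 \<le> t \<Longrightarrow> \<omega> (2 * t) \<le> L * (\<omega> t + 1)"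
    by (auto simp: general_weight_function_def)
  \<comment> \<open>of the \<open>L + 2\<close> multiples of \<open>\<omega>\<close>, \<open>L\<close> come from \<open>\<omega> (2 r)\<close>, one from \<open>ln r\<close> and one from the constants\<close>
  define \<mu> where "\<mu> = c / (L + 2)"
  have \<mu>: "0 < \<mu>" using c L by (simp add: \<mu>_def)
  obtain \<kappa> C where \<kappa>: "0 < \<kappa>" and C: "0 < C" and upper: "\<And>r. 1 \<le> r \<Longrightarrow>
      S_norm G \<omega> 1 \<kappa> (line_fun (translated_gaussian r 0)) \<le> ennreal (C * exp (\<omega> (2 * r)))"
    using translated_gaussian_S_norm_upper[OF \<omega>] by metis
  obtain D where D: "0 < D" "\<And>f B. f \<in> smooth 1 \<Longrightarrow> 0 < B \<Longrightarrow> S_norm G \<omega> 1 \<kappa> f \<le> ennreal B \<Longrightarrow>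
      S_norm H \<sigma> 1 \<mu> f \<le> ennreal (D * B)"
    using incl \<kappa> \<mu> unfolding continuously_included_iff[OF g\<omega>] by metis
  have main: "\<sigma> r / \<mu> \<le> ln (D * C) + L + L * \<omega> r + ln r" if r: "1 < r" for r
  proof -
    have "S_norm H \<sigma> 1 \<mu> (line_fun (translated_gaussian r 0)) \<le> ennreal (D * (C * exp (\<omega> (2 * r))))"
      using upper[of r] r C by (intro D(2) line_fun_smooth translated_gaussian_deriv) auto
    then have "exp (\<sigma> r / \<mu>) \<le> D * (C * exp (\<omega> (2 * r))) * r"
      using D(1) C r by (intro translated_gaussian_S_norm_lower[OF \<sigma> \<mu>]) auto
    also have "\<dots> \<le> D * (C * exp (L * (\<omega> r + 1))) * r"
      using L(2)[of r] D(1) C r by simp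
    also have "\<dots> = exp (ln (D * C) + L + L * \<omega> r + ln r)"
      using D(1) C r by (simp add: exp_add distrib_left mult_ac)
    finally show ?thesis by simp
  qed
  have "ln \<in> o[at_top](\<omega>)" using g\<omega> by (simp add: general_weight_function_def)
  then have "eventually (\<lambda>r. norm (ln r) \<le> 1 * norm (\<omega> r)) at_top"
    by (rule landau_o.smallD) simp
  moreover have "eventually (\<lambda>r. ln (D * C) + L \<le> ln r) at_top"
    using ln_at_top by (simp add: filterlim_at_top)
  ultimately show "eventually (\<lambda>r. norm (\<sigma> r) \<le> c * norm (\<omega> r)) at_top"
    using eventually_gt_at_top[of 1]
  proof eventually_elim
    case (elim r)
    have nonneg: "0 \<le> \<omega> r" "0 \<le> \<sigma> r" using g\<omega> \<sigma> elim by (auto simp: general_weight_function_def)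
    have "ln r \<le> \<omega> r" using elim nonneg by simp
    then have "\<sigma> r / \<mu> \<le> (L + 2) * \<omega> r"
      using main[of r] elim by (simp add: algebra_simps)
    then have "\<sigma> r \<le> (L + 2) * \<omega> r * \<mu>" using \<mu> by (simp add: pos_divide_le_eq)
    also have "\<dots> = c * \<omega> r" using L by (simp add: \<mu>_def)
    finally show ?case using nonneg by simp
  qed
qed

theorem theorem4p2:
  fixes \<omega> \<sigma> :: "real \<Rightarrow> real" and G H :: growth
  shows
    "(weight_function \<omega> \<and> weight_function \<sigma> \<and> \<sigma> \<in> o[at_top](\<lambda>t. t\<^sup>2) \<longrightarrow>
        (\<sigma> \<in> o[at_top](\<omega>) \<longleftrightarrow> (\<forall>d\<ge>1. continuously_included G H \<omega> \<sigma> d)))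
     \<and> (general_weight_function \<omega> \<and> general_weight_function \<sigma> \<and> \<sigma> \<in> o[at_top](\<omega>) \<longrightarrow>
        (\<forall>d\<ge>1. continuously_included G H \<omega> \<sigma> d))
     \<and> (weight_function \<omega> \<and> weight_function \<sigma> \<and> \<sigma> \<in> o[at_top](\<lambda>t. t\<^sup>2) \<and>
          continuously_included G H \<omega> \<sigma> 1 \<longrightarrow>
        \<sigma> \<in> o[at_top](\<omega>))"
  using continuously_included_of_smallo[of \<omega> \<sigma> G H] smallo_of_continuously_included[of \<omega> \<sigma> G H]
  unfolding weight_function_def by blast

end
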